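(* Let $k$ be an infinite field of characteristic $p>0$. Let $V$ and $W$ be polynomial $\mathrm{GL}$-representations that are homogeneous of positive degrees $n$ and $m$ respectively. Let $U\subset V\otimes W$ be a nonzero subrepresentation. Let $u$ be a minimally flat weight vector in $U$ and write $u=\sum_{i=1}^s v_i\otimes w_i$, where $\{v_i\}$ and $\{w_i\}$ are linearly independent sets of weight vectors of $V$ and $W$ respectively. Then for all $i\ge 1$, the weights $\mathrm{wt}(v_i)$ and $\mathrm{wt}(w_i)$ have disjoint support.
   Context: $\mathbf{V}$ is the $k$-vector space with basis $e_1,e_2,\ldots$, and $\mathrm{GL}$ is the group of automorphisms of $\mathbf{V}$ fixing all but finitely many of the $e_i$. A polynomial representation of $\mathrm{GL}$ is a subquotient of a (possibly infinite) direct sum of tensor powers $\mathbf{V}^{\otimes n}$; it is homogeneous of degree $n$ if it is a subquotient of a direct sum of copies of $\mathbf{V}^{\otimes n}$. Weights are taken with respect to the diagonal torus, and are sequences $\lambda=(\lambda_1,\lambda_2,\ldots)$ of nonnegative integers with finitely many nonzero terms; $\mathrm{wt}(v)$ is the weight of a weight vector $v$, and the support of $\lambda$ is $\{i:\lambda_i\ne0\}$. A weight $\lambda$ is flat if each $\lambda_i$ is $0$ or a power of $p$ (including $1=p^0$). The $p$-magnitude of a flat weight $\lambda$ is the sequence $p\text{-mag}(\lambda)=(n_0,n_1,\ldots)$ with $n_i=\#\{j:\lambda_j=p^i\}$. Flat weights are ordered by: $\lambda<\mu$ if and only if $p\text{-mag}(\lambda)>p\text{-mag}(\mu)$ in the lexicographic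 order on sequences of integers. A nonzero weight vector $u$ in a representation $U$ is flat if its weight is flat, and minimally flat if $\mathrm{wt}(u)$ is minimal, for this ordering, among all flat weights occurring in $U$. *)

theory Defs
  imports "HOL-Library.Poly_Mapping" Complex_Main
begin

section \<open>Free vector spaces\<close>

text \<open>The type \<open>'a \<Rightarrow>\<^sub>0 'k\<close> of finitely supported functions is the free vector space on \<open>'a\<close>,
  with basis \<open>Poly_Mapping.single a 1\<close>.\<close>

definition fscale :: "'k::field \<Rightarrow> ('a \<Rightarrow>\<^sub>0 'k) \<Rightarrow> ('a \<Rightarrow>\<^sub>0 'k)" where
  "fscale c f = Poly_Mapping.map ((*) c) f"

lemma lookup_fscale [simp]: "Poly_Mapping.lookup (fscale c f) x = c * Poly_Mapping.lookup f x"
  by (simp add: fscale_def map.rep_eq when_def)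

lemma vector_space_fscale: "vector_space (fscale :: 'k::field \<Rightarrow> ('a \<Rightarrow>\<^sub>0 'k) \<Rightarrow> _)"
  by standard (auto intro!: poly_mapping_eqI simp: lookup_add algebra_simps)

section \<open>The infinite general linear group and its representations\<close>

text \<open>\<open>\<^bold>V = nat \<Rightarrow>\<^sub>0 'k\<close>. The basis is indexed from 0 instead of 1.\<close>

abbreviation basis_vec :: "nat \<Rightarrow> (nat \<Rightarrow>\<^sub>0 'k::field)" where
  "basis_vec i \<equiv> Poly_Mapping.single i 1"

type_synonym 'k gl = "(nat \<Rightarrow>\<^sub>0 'k) \<Rightarrow> (nat \<Rightarrow>\<^sub>0 'k)"

definition GL :: "'k::field gl set" where
  "GL = {g. Vector_Spaces.linear fscale fscale g \<and> bij g \<and>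
            finite {i. g (basis_vec i) \<noteq> basis_vec i}}"

text \<open>The underlying space is the whole type \<open>'v\<close>; only the values of \<open>\<rho>\<close> on \<open>GL\<close> matter.\<close>

definition gl_rep :: "('k::field \<Rightarrow> 'v::ab_group_add \<Rightarrow> 'v) \<Rightarrow> ('k gl \<Rightarrow> 'v \<Rightarrow> 'v) \<Rightarrow> bool" where
  "gl_rep s \<rho> \<longleftrightarrow> vector_space s \<and>
     (\<forall>g\<in>GL. Vector_Spaces.linear s s (\<rho> g)) \<and>
     \<rho> id = id \<and> (\<forall>g\<in>GL. \<forall>h\<in>GL. \<rho> (g \<circ> h) = \<rho> g \<circ> \<rho> h)"

definition subrep ::
  "('k::field \<Rightarrow> 'v::ab_group_add \<Rightarrow> 'v) \<Rightarrow> ('k gl \<Rightarrow> 'v \<Rightarrow> 'v) \<Rightarrow> 'v set \<Rightarrow> bool" where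
  "subrep s \<rho> U \<longleftrightarrow> module.subspace s U \<and> (\<forall>g\<in>GL. \<forall>u\<in>U. \<rho> g u \<in> U)"

section \<open>Tensor powers and polynomial representations\<close>

text \<open>\<open>nat list \<Rightarrow>\<^sub>0 'k\<close> is the tensor algebra of \<open>\<^bold>V\<close>: the word \<open>[i\<^sub>1, \<dots>, i\<^sub>n]\<close> stands for
  \<open>e\<^bsub>i\<^sub>1\<^esub> \<otimes> \<dots> \<otimes> e\<^bsub>i\<^sub>n\<^esub>\<close>, so the \<open>n\<close>-th tensor power is the span of the words of length \<open>n\<close>.
  \<open>pure_tensor [x\<^sub>1, \<dots>, x\<^sub>n]\<close> is \<open>x\<^sub>1 \<otimes> \<dots> \<otimes> x\<^sub>n\<close>.\<close>

fun pure_tensor :: "(nat \<Rightarrow>\<^sub>0 'k::field) list \<Rightarrow> (nat list \<Rightarrow>\<^sub>0 'k)" where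
  "pure_tensor [] = Poly_Mapping.single [] 1"
| "pure_tensor (x # xs) =
     (\<Sum>i\<in>Poly_Mapping.keys x. \<Sum>w\<in>Poly_Mapping.keys (pure_tensor xs).
        Poly_Mapping.single (i # w)
          (Poly_Mapping.lookup x i * Poly_Mapping.lookup (pure_tensor xs) w))"

definition tensor_act :: "'k::field gl \<Rightarrow> (nat list \<Rightarrow>\<^sub>0 'k) \<Rightarrow> (nat list \<Rightarrow>\<^sub>0 'k)" where
  "tensor_act g f = (\<Sum>w\<in>Poly_Mapping.keys f.
     fscale (Poly_Mapping.lookup f w) (pure_tensor (map (\<lambda>i. g (basis_vec i)) w)))"

text \<open>The direct sum over \<open>i \<in> I\<close> of the tensor powers of degree \<open>d i\<close>, as a subspace of the
  direct sum \<open>'i \<Rightarrow>\<^sub>0 (nat list \<Rightarrow>\<^sub>0 'k)\<close> of copies of the tensor algebra.\<close>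

definition tensor_sum :: "'i set \<Rightarrow> ('i \<Rightarrow> nat) \<Rightarrow> ('i \<Rightarrow>\<^sub>0 (nat list \<Rightarrow>\<^sub>0 'k::field)) set" where
  "tensor_sum I d = {x. Poly_Mapping.keys x \<subseteq> I \<and>
     (\<forall>i\<in>I. \<forall>w\<in>Poly_Mapping.keys (Poly_Mapping.lookup x i). length w = d i)}"

definition sum_scale ::
  "'k::field \<Rightarrow> ('i \<Rightarrow>\<^sub>0 (nat list \<Rightarrow>\<^sub>0 'k)) \<Rightarrow> ('i \<Rightarrow>\<^sub>0 (nat list \<Rightarrow>\<^sub>0 'k))" where
  "sum_scale c x = Poly_Mapping.map (fscale c) x"

definition sum_act ::
  "'k::field gl \<Rightarrow> ('i \<Rightarrow>\<^sub>0 (nat list \<Rightarrow>\<^sub>0 'k)) \<Rightarrow> ('i \<Rightarrow>\<^sub>0 (nat list \<Rightarrow>\<^sub>0 'k))" where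
  "sum_act g x = Poly_Mapping.map (tensor_act g) x"

lemma lookup_sum_scale [simp]:
  "Poly_Mapping.lookup (sum_scale c x) i = fscale c (Poly_Mapping.lookup x i)"
proof -
  have "fscale c (0 :: nat list \<Rightarrow>\<^sub>0 'a) = 0"
    by (auto intro!: poly_mapping_eqI)
  then show ?thesis
    by (simp add: sum_scale_def map.rep_eq when_def)
qed

lemma vector_space_sum_scale: 
  "vector_space (sum_scale :: 'k::field \<Rightarrow> ('i \<Rightarrow>\<^sub>0 (nat list \<Rightarrow>\<^sub>0 'k)) \<Rightarrow> _)"
  by standard (auto intro!: poly_mapping_eqI simp: lookup_add algebra_simps)

text \<open>Subquotients of the above direct sum: \<open>A\<close> is a subrepresentation, and \<open>q\<close> is an
  equivariant linear surjection from \<open>A\<close>, so that the representation is \<open>A / ker q\<close>.\<close>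

definition polynomial_rep ::
  "'i set \<Rightarrow> ('i \<Rightarrow> nat) \<Rightarrow> ('k::field \<Rightarrow> 'v::ab_group_add \<Rightarrow> 'v) \<Rightarrow> ('k gl \<Rightarrow> 'v \<Rightarrow> 'v) \<Rightarrow> bool"
where
  "polynomial_rep I d s \<rho> \<longleftrightarrow> gl_rep s \<rho> \<and>
     (\<exists>A q. A \<subseteq> tensor_sum I d \<and> subrep sum_scale sum_act A \<and>
        (\<forall>x\<in>A. \<forall>y\<in>A. q (x + y) = q x + q y) \<and>
        (\<forall>c. \<forall>x\<in>A. q (sum_scale c x) = s c (q x)) \<and>
        (\<forall>g\<in>GL. \<forall>x\<in>A. q (sum_act g x) = \<rho> g (q x)) \<and>
        q ` A = UNIV)"

definition homogeneous_polynomial_rep ::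
  "'i set \<Rightarrow> nat \<Rightarrow> ('k::field \<Rightarrow> 'v::ab_group_add \<Rightarrow> 'v) \<Rightarrow> ('k gl \<Rightarrow> 'v \<Rightarrow> 'v) \<Rightarrow> bool"
where
  "homogeneous_polynomial_rep I n s \<rho> \<longleftrightarrow> polynomial_rep I (\<lambda>_. n) s \<rho>"

section \<open>Tensor product of two representations\<close>

definition bilinear_relations ::
  "('k::field \<Rightarrow> 'v::ab_group_add \<Rightarrow> 'v) \<Rightarrow> ('k \<Rightarrow> 'w::ab_group_add \<Rightarrow> 'w) \<Rightarrow> ('v \<times> 'w \<Rightarrow>\<^sub>0 'k) set"
where
  "bilinear_relations sV sW =
     {Poly_Mapping.single (v + v', w) 1
        - Poly_Mapping.single (v, w) 1 - Poly_Mapping.single (v', w) 1 | v v' w. True}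
   \<union> {Poly_Mapping.single (v, w + w') 1
        - Poly_Mapping.single (v, w) 1 - Poly_Mapping.single (v, w') 1 | v w w'. True}
   \<union> {Poly_Mapping.single (sV c v, w) 1 - Poly_Mapping.single (v, w) c | c v w. True}
   \<union> {Poly_Mapping.single (v, sW c w) 1 - Poly_Mapping.single (v, w) c | c v w. True}"

definition eval_tensors ::
  "('k::field \<Rightarrow> 't::ab_group_add \<Rightarrow> 't) \<Rightarrow> ('v \<Rightarrow> 'w \<Rightarrow> 't) \<Rightarrow> ('v \<times> 'w \<Rightarrow>\<^sub>0 'k) \<Rightarrow> 't" where
  "eval_tensors sT tens f =
     (\<Sum>(v, w)\<in>Poly_Mapping.keys f. sT (Poly_Mapping.lookup f (v, w)) (tens v w))"

text \<open>The space \<open>'t\<close> with \<open>tens v w = v \<otimes> w\<close> is a tensor product: the linear map from the free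
  vector space on pairs given by \<open>(v, w) \<mapsto> v \<otimes> w\<close> identifies \<open>'t\<close> with the quotient by the
  bilinearity relations. The usual universal property is proved below.\<close>

definition tensor_product ::
  "('k::field \<Rightarrow> 'v::ab_group_add \<Rightarrow> 'v) \<Rightarrow> ('k \<Rightarrow> 'w::ab_group_add \<Rightarrow> 'w) \<Rightarrow>
   ('k \<Rightarrow> 't::ab_group_add \<Rightarrow> 't) \<Rightarrow> ('v \<Rightarrow> 'w \<Rightarrow> 't) \<Rightarrow> bool" where
  "tensor_product sV sW sT tens \<longleftrightarrow>
     vector_space sV \<and> vector_space sW \<and> vector_space sT \<and>
     surj (eval_tensors sT tens) \<and>
     {f. eval_tensors sT tens f = 0} = module.span fscale (bilinear_relations sV sW)"

definition tensor_product_rep ::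
  "('k::field \<Rightarrow> 'v::ab_group_add \<Rightarrow> 'v) \<Rightarrow> ('k gl \<Rightarrow> 'v \<Rightarrow> 'v) \<Rightarrow>
   ('k \<Rightarrow> 'w::ab_group_add \<Rightarrow> 'w) \<Rightarrow> ('k gl \<Rightarrow> 'w \<Rightarrow> 'w) \<Rightarrow>
   ('k \<Rightarrow> 't::ab_group_add \<Rightarrow> 't) \<Rightarrow> ('k gl \<Rightarrow> 't \<Rightarrow> 't) \<Rightarrow> ('v \<Rightarrow> 'w \<Rightarrow> 't) \<Rightarrow> bool" where
  "tensor_product_rep sV \<rho>V sW \<rho>W sT \<rho>T tens \<longleftrightarrow>
     tensor_product sV sW sT tens \<and>
     (\<forall>g\<in>GL. Vector_Spaces.linear sT sT (\<rho>T g) \<and>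
        (\<forall>v w. \<rho>T g (tens v w) = tens (\<rho>V g v) (\<rho>W g w)))"

definition bilinear_map ::
  "('k::field \<Rightarrow> 'v::ab_group_add \<Rightarrow> 'v) \<Rightarrow> ('k \<Rightarrow> 'w::ab_group_add \<Rightarrow> 'w) \<Rightarrow>
   ('k \<Rightarrow> 't::ab_group_add \<Rightarrow> 't) \<Rightarrow> ('v \<Rightarrow> 'w \<Rightarrow> 't) \<Rightarrow> bool" where
  "bilinear_map sV sW sT b \<longleftrightarrow>
     (\<forall>w. Vector_Spaces.linear sV sT (\<lambda>v. b v w)) \<and> (\<forall>v. Vector_Spaces.linear sW sT (b v))"

lemma eval_tensors_superset:
  assumes "vector_space sT" "finite S" "Poly_Mapping.keys f \<subseteq> S"
  shows "eval_tensors sT tens f =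
    (\<Sum>x\<in>S. sT (Poly_Mapping.lookup f x) (tens (fst x) (snd x)))"
proof -
  interpret vector_space sT by fact
  show ?thesis unfolding eval_tensors_def case_prod_beta prod.collapse
    by (rule sum.mono_neutral_left) (use assms in \<open>auto simp: in_keys_iff\<close>)
qed

lemma linear_eval_tensors:
  assumes "vector_space sT"
  shows "Vector_Spaces.linear fscale sT (eval_tensors sT tens)"
proof -
  interpret T: vector_space sT by fact
  interpret F: vector_space "fscale :: 'a \<Rightarrow> ('c \<times> 'd \<Rightarrow>\<^sub>0 'a) \<Rightarrow> _" by (rule vector_space_fscale)
  show ?thesis
  proof (unfold_locales)
    fix f g :: "'c \<times> 'd \<Rightarrow>\<^sub>0 'a" and c :: 'a
    let ?S = "Poly_Mapping.keys f \<union> Poly_Mapping.keys g"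
    have k: "Poly_Mapping.keys (f + g) \<subseteq> ?S" by (rule keys_add)
    show "eval_tensors sT tens (f + g) = eval_tensors sT tens f + eval_tensors sT tens g"
      by (subst (1 2 3) eval_tensors_superset[OF assms, where S = ?S])
         (use k in \<open>auto simp: lookup_add T.scale_left_distrib sum.distrib\<close>)
    have k: "Poly_Mapping.keys (fscale c f) \<subseteq> Poly_Mapping.keys f" by (auto simp: in_keys_iff)
    show "eval_tensors sT tens (fscale c f) = sT c (eval_tensors sT tens f)"
      by (subst (1 2) eval_tensors_superset[OF assms, where S = "Poly_Mapping.keys f"])
         (use k in \<open>auto simp: T.scale_sum_right\<close>)
  qed
qed

lemma eval_tensors_single:
  assumes "vector_space sT"
  shows "eval_tensors sT tens (Poly_Mapping.single (v, w) c) = sT c (tens v w)"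
  by (subst eval_tensors_superset[OF assms, where S = "{(v, w)}"]) auto

lemma eval_tensors_relations:
  assumes "bilinear_map sV sW sT b" and vs: "vector_space sT"
    and r: "r \<in> bilinear_relations sV sW"
  shows "eval_tensors sT b r = 0"
proof -
  interpret T: vector_space sT by fact
  interpret E: Vector_Spaces.linear fscale sT "eval_tensors sT b" by (rule linear_eval_tensors[OF vs])
  from assms(1) have L: "Vector_Spaces.linear sV sT (\<lambda>v. b v w)"
    and R: "Vector_Spaces.linear sW sT (b v)" for v w
    by (auto simp: bilinear_map_def)
  have "b (x + x') y = b x y + b x' y" "b (sV c x) y = sT c (b x y)" for x x' y c
    using L[of y] by (auto simp: Vector_Spaces.linear_iff)
  moreover have "b x (y + y') = b x y + b x y'" "b x (sW c y) = sT c (b x y)" for x y y' c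
    using R[of x] by (auto simp: Vector_Spaces.linear_iff)
  ultimately show ?thesis
    using r by (auto simp: bilinear_relations_def E.diff eval_tensors_single[OF vs])
qed

lemma tensor_product_bilinear:
  assumes "tensor_product sV sW sT tens"
  shows "bilinear_map sV sW sT tens"
proof -
  have vs: "vector_space sV" "vector_space sW" "vector_space sT"
    using assms by (auto simp: tensor_product_def)
  interpret T: vector_space sT by fact
  interpret F: vector_space "fscale :: 'a \<Rightarrow> ('b \<times> 'c \<Rightarrow>\<^sub>0 'a) \<Rightarrow> _" by (rule vector_space_fscale)
  interpret E: Vector_Spaces.linear fscale sT "eval_tensors sT tens"
    by (rule linear_eval_tensors[OF vs(3)])
  have z: "eval_tensors sT tens r = 0" if "r \<in> bilinear_relations sV sW" for r
    using assms F.span_base[OF that] by (auto simp: tensor_product_def)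
  have "tens (v + v') w - tens v w - tens v' w = 0" for v v' w
    using z[of "Poly_Mapping.single (v + v', w) 1
        - Poly_Mapping.single (v, w) 1 - Poly_Mapping.single (v', w) 1"]
    unfolding E.diff eval_tensors_single[OF vs(3)] bilinear_relations_def T.scale_one by blast
  moreover have "tens v (w + w') - tens v w - tens v w' = 0" for v w w'
    using z[of "Poly_Mapping.single (v, w + w') 1
        - Poly_Mapping.single (v, w) 1 - Poly_Mapping.single (v, w') 1"]
    unfolding E.diff eval_tensors_single[OF vs(3)] bilinear_relations_def T.scale_one by blast
  moreover have "tens (sV c v) w - sT c (tens v w) = 0" for c v w
    using z[of "Poly_Mapping.single (sV c v, w) 1 - Poly_Mapping.single (v, w) c"]
    unfolding E.diff eval_tensors_single[OF vs(3)] bilinear_relations_def T.scale_one by blast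
  moreover have "tens v (sW c w) - sT c (tens v w) = 0" for c v w
    using z[of "Poly_Mapping.single (v, sW c w) 1 - Poly_Mapping.single (v, w) c"]
    unfolding E.diff eval_tensors_single[OF vs(3)] bilinear_relations_def T.scale_one by blast
  ultimately show ?thesis using vs
    by (auto simp: bilinear_map_def Vector_Spaces.linear_iff algebra_simps)
qed

theorem tensor_product_universal:
  assumes tp: "tensor_product sV sW sT tens" and vs: "vector_space sX"
    and bil: "bilinear_map sV sW sX b"
  shows "\<exists>!h. Vector_Spaces.linear sT sX h \<and> (\<forall>v w. h (tens v w) = b v w)"
proof -
  have vsT: "vector_space sT" and sj: "surj (eval_tensors sT tens)"
    and ker: "{f. eval_tensors sT tens f = 0} = module.span fscale (bilinear_relations sV sW)"
    using tp by (auto simp: tensor_product_def)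
  interpret T: vector_space sT by fact
  interpret X: vector_space sX by fact
  interpret F: vector_space "fscale :: 'a \<Rightarrow> ('b \<times> 'c \<Rightarrow>\<^sub>0 'a) \<Rightarrow> _" by (rule vector_space_fscale)
  interpret E: Vector_Spaces.linear fscale sT "eval_tensors sT tens"
    by (rule linear_eval_tensors[OF vsT])
  interpret B: Vector_Spaces.linear fscale sX "eval_tensors sX b"
    by (rule linear_eval_tensors[OF vs])
  have "eval_tensors sX b r = 0" if "r \<in> F.span (bilinear_relations sV sW)" for r
    using that
    by (induction rule: F.span_induct_alt)
       (auto simp: B.add B.scale eval_tensors_relations[OF bil vs])
  then have k: "eval_tensors sX b r = 0" if "eval_tensors sT tens r = 0" for r
    using ker that by auto
  have k2: "eval_tensors sX b f = eval_tensors sX b g"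
    if "eval_tensors sT tens f = eval_tensors sT tens g" for f g
    using k[of "f - g"] that by (simp add: E.diff B.diff)
  define h where "h t = eval_tensors sX b (SOME f. eval_tensors sT tens f = t)" for t
  have h: "h (eval_tensors sT tens f) = eval_tensors sX b f" for f
    unfolding h_def by (rule k2) (rule someI[where P = "\<lambda>g. eval_tensors sT tens g = _"], simp)
  show ?thesis
  proof (rule ex1I[of _ h], intro conjI allI)
    show "Vector_Spaces.linear sT sX h"
    proof (unfold Vector_Spaces.linear_iff, intro conjI allI)
      fix x y c
      obtain f where f: "x = eval_tensors sT tens f" using sj by (rule surjE)
      obtain g where g: "y = eval_tensors sT tens g" using sj by (rule surjE)
      show "h (x + y) = h x + h y" by (simp add: f g h B.add flip: E.add)
      show "h (sT c x) = sX c (h x)" by (simp add: f h B.scale flip: E.scale)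
    qed fact+
    show "h (tens v w) = b v w" for v w
      using h[of "Poly_Mapping.single (v, w) 1"]
      by (simp add: eval_tensors_single[OF vs] eval_tensors_single[OF vsT])
  next
    fix h' assume h': "Vector_Spaces.linear sT sX h' \<and> (\<forall>v w. h' (tens v w) = b v w)"
    then interpret H: Vector_Spaces.linear sT sX h' by simp
    show "h' = h"
    proof
      fix t
      obtain f where f: "t = eval_tensors sT tens f" using sj by (rule surjE)
      have "h' t = eval_tensors sX b f"
        using h' by (simp add: f eval_tensors_def H.sum H.scale case_prod_beta)
      then show "h' t = h t" by (simp add: f h)
    qed
  qed
qed

section \<open>Weights\<close>

definition torus :: "(nat \<Rightarrow> 'k::field) set" where
  "torus = {t. (\<forall>i. t i \<noteq> 0) \<and> finite {i. t i \<noteq> 1}}"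

definition diag :: "(nat \<Rightarrow> 'k::field) \<Rightarrow> 'k gl" where
  "diag t = Poly_Mapping.mapp (\<lambda>i c. t i * c)"

type_synonym weight = "nat \<Rightarrow>\<^sub>0 nat"

text \<open>\<open>v\<close> is a (nonzero) weight vector with \<open>wt v = \<lambda>\<close>; the support of \<open>\<lambda>\<close> is
  \<open>Poly_Mapping.keys \<lambda>\<close>. For infinite \<open>'k\<close> the weight is determined by \<open>v\<close>.\<close>

definition weight_vector ::
  "('k::field \<Rightarrow> 'v::ab_group_add \<Rightarrow> 'v) \<Rightarrow> ('k gl \<Rightarrow> 'v \<Rightarrow> 'v) \<Rightarrow> weight \<Rightarrow> 'v \<Rightarrow> bool" where
  "weight_vector s \<rho> l v \<longleftrightarrow> v \<noteq> 0 \<and>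
     (\<forall>t\<in>torus. \<rho> (diag t) v
        = s (\<Prod>i\<in>Poly_Mapping.keys l. t i ^ Poly_Mapping.lookup l i) v)"

definition flat :: "nat \<Rightarrow> weight \<Rightarrow> bool" where
  "flat p l \<longleftrightarrow>
     (\<forall>i. Poly_Mapping.lookup l i = 0 \<or> (\<exists>j. Poly_Mapping.lookup l i = p ^ j))"

definition p_mag :: "nat \<Rightarrow> weight \<Rightarrow> nat \<Rightarrow> nat" where
  "p_mag p l i = card {j. Poly_Mapping.lookup l j = p ^ i}"

text \<open>The order on flat weights is the reverse of the lexicographic order \<^const>\<open>less_fun\<close> on
  \<open>p\<close>-magnitudes.\<close>

definition flat_less :: "nat \<Rightarrow> weight \<Rightarrow> weight \<Rightarrow> bool" where
  "flat_less p l m \<longleftrightarrow> less_fun (p_mag p m) (p_mag p l)"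

definition minimally_flat ::
  "nat \<Rightarrow> ('k::field \<Rightarrow> 'v::ab_group_add \<Rightarrow> 'v) \<Rightarrow> ('k gl \<Rightarrow> 'v \<Rightarrow> 'v) \<Rightarrow> 'v set \<Rightarrow> 'v \<Rightarrow> bool"
where
  "minimally_flat p s \<rho> U u \<longleftrightarrow> u \<in> U \<and>
     (\<exists>l. weight_vector s \<rho> l u \<and> flat p l \<and>
        \<not> (\<exists>m. \<exists>x\<in>U. weight_vector s \<rho> m x \<and> flat p m \<and> flat_less p m l))"

end

theory Submission
  imports Defs "HOL-Algebra.Exponent" "HOL-Computational_Algebra.Polynomial"
begin

text \<open>
  Suppose that some \<open>i\<close> and \<open>j\<close> have \<open>j\<close> in the supports of both \<open>a i = wt (v i)\<close> and
  \<open>b i = wt (w i)\<close>. Linear independence forces \<open>a i + b i = \<mu>\<close>, the weight of \<open>u\<close>, so the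
  \<open>j\<close>-th entry of \<open>\<mu>\<close>, a power \<open>p\<^sup>r\<close>, is the sum of two positive numbers \<open>A = a i j\<close> and
  \<open>B = b i j\<close>. The contradiction is a flat weight of \<open>U\<close> in which \<open>p\<^sup>r\<close> has been replaced by
  smaller powers of \<open>p\<close>: it precedes \<open>\<mu>\<close> in the order on flat weights.

  Such weights come from the substitutions \<open>e\<^sub>j \<mapsto> e\<^sub>j + t e\<^sub>k\<close>, where \<open>k\<close> lies outside the
  support of the weight at hand. On a vector of weight \<open>\<mu>\<close> with \<open>c = \<mu> j\<close> the substitution acts
  as \<open>x \<mapsto> \<Sum>d\<le>c. t\<^sup>d X\<^sub>d\<close>, where \<open>X\<^sub>d\<close> has weight \<open>\<mu>\<close> with its \<open>j\<close>-th entry \<open>c\<close> split into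
  \<open>c - d\<close> at \<open>j\<close> and \<open>d\<close> at \<open>k\<close>. Since the field is infinite, the \<open>X\<^sub>d\<close> lie in every
  subrepresentation containing \<open>x\<close>. Composing with \<open>e\<^sub>k \<mapsto> e\<^sub>k + s e\<^sub>j\<close> recovers
  \<open>(c choose d) x\<close> from \<open>X\<^sub>d\<close>, so \<open>X\<^sub>d \<noteq> 0\<close> whenever \<open>p\<close> does not divide \<open>c choose d\<close>
  (\<open>split_weight_vector\<close>).

  The contradiction then takes two splittings. The first one splits \<open>p\<^sup>r\<close> into \<open>B\<close> and \<open>A\<close>.
  The binomial coefficient vanishes modulo \<open>p\<close> here, but the component of \<open>X\<^sub>A\<close> in which the
  factor from \<open>V\<close> has moved completely from \<open>j\<close> to \<open>k\<close> and the factor from \<open>W\<close> not at all is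
  the sum of the \<open>(\<tau> v\<^sub>l) \<otimes> w\<^sub>l\<close> with \<open>a l j = A\<close>, where \<open>\<tau>\<close> exchanges \<open>e\<^sub>j\<close> and \<open>e\<^sub>k\<close>; by
  independence it is not zero (\<open>column_expansion_tensor_nonzero\<close>). The second one splits
  \<open>A\<close>, \<open>B\<close> and their descendants further until all entries are powers of \<open>p\<close>. This is always
  possible: an entry \<open>c = p\<^sup>i m\<close> with \<open>m > 1\<close> prime to \<open>p\<close> has \<open>c choose p\<^sup>i\<close> prime to
  \<open>p\<close> (\<open>flattening\<close>).
\<close>

section \<open>Linear functionals and comparison of coefficients\<close>

lemma vector_space_mult: "vector_space ((*) :: 'k::field \<Rightarrow> 'k \<Rightarrow> 'k)"
  by unfold_locales (auto simp: algebra_simps)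

lemma separating_functional:
  assumes "vector_space (sc :: 'k::field \<Rightarrow> 'v::ab_group_add \<Rightarrow> 'v)"
    and U: "module.subspace sc U" and z: "z \<notin> U"
  obtains \<phi> where "Vector_Spaces.linear sc (*) \<phi>" "\<phi> z = 1" "\<And>x. x \<in> U \<Longrightarrow> \<phi> x = 0"
proof -
  interpret V: vector_space sc by fact
  interpret P: vector_space_pair sc "(*) :: 'k \<Rightarrow> 'k \<Rightarrow> 'k"
    by (intro vector_space_pair.intro assms(1) vector_space_mult)
  obtain B where B: "B \<subseteq> U" "V.independent B" "U \<subseteq> V.span B"
    using V.maximal_independent_subset by blast
  have "z \<notin> V.span B"
    using z V.span_minimal[OF B(1) U] by auto
  then have "V.independent (insert z B)"
    using B(2) V.independent_insertI by blast
  then obtain \<phi> where lin: "Vector_Spaces.linear sc (*) \<phi>"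
    and \<phi>: "\<forall>x\<in>insert z B. \<phi> x = (if x = z then 1 else 0)"
    using P.linear_independent_extend[of "insert z B" "\<lambda>x. if x = z then 1 else 0"] by blast
  interpret \<phi>: Vector_Spaces.linear sc "(*)" \<phi> by fact
  have "z \<notin> B" using z B(1) by auto
  then have B0: "\<phi> x = 0" if "x \<in> B" for x
    using that \<phi> by auto
  have "\<phi> x = 0" if "x \<in> V.span B" for x
    using that by (induction rule: V.span_induct_alt) (auto simp: \<phi>.add \<phi>.scale \<phi>.zero B0)
  then show thesis
    using that[OF lin] \<phi> B(3) by auto
qed

lemma dual_functional:
  assumes "vector_space (sc :: 'k::field \<Rightarrow> 'v::ab_group_add \<Rightarrow> 'v)"
    and "\<not> module.dependent sc (v ` N)" and "inj_on v N" and "i \<in> N"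
  obtains \<phi> where "Vector_Spaces.linear sc (*) \<phi>" "\<And>l. l \<in> N \<Longrightarrow> \<phi> (v l) = (if l = i then 1 else 0)"
proof -
  interpret V: vector_space sc by fact
  interpret P: vector_space_pair sc "(*) :: 'k \<Rightarrow> 'k \<Rightarrow> 'k"
    by (intro vector_space_pair.intro assms(1) vector_space_mult)
  obtain \<phi> where "Vector_Spaces.linear sc (*) \<phi>"
    and "\<forall>x\<in>v ` N. \<phi> x = (if x = v i then 1 else 0)"
    using P.linear_independent_extend[OF assms(2), of "\<lambda>x. if x = v i then 1 else 0"] by blast
  then show thesis
    using that[of \<phi>] inj_onD[OF assms(3), of _ i] assms(4) by fastforce
qed

text \<open>A functional that vanishes on \<open>U\<close> turns the hypothesis into a scalar polynomial with
  infinitely many zeros, so it also vanishes on each coefficient, and such functionals separate \<open>U\<close> from the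
  vectors outside it. The exponents \<open>e\<close> and \<open>e'\<close> may
  repeat; this is how the expansions below are sorted by weight.\<close>

lemma coefficients_mem:
  fixes sc :: "'k::field \<Rightarrow> 'v::ab_group_add \<Rightarrow> 'v"
  assumes inf: "infinite (UNIV :: 'k set)" and vs: "vector_space sc"
    and U: "module.subspace sc U" and fin: "finite S" "finite S'"
    and mem: "\<And>t. t \<noteq> 0 \<Longrightarrow>
      (\<Sum>m\<in>S. sc (t ^ e m) (y m)) - (\<Sum>m\<in>S'. sc (t ^ e' m) (y' m)) \<in> U"
  shows "(\<Sum>m | m \<in> S \<and> e m = n. y m) - (\<Sum>m | m \<in> S' \<and> e' m = n. y' m) \<in> U"
    (is "?z \<in> U")
proof (rule ccontr)
  assume "?z \<notin> U"
  then obtain \<phi> where lin: "Vector_Spaces.linear sc (*) \<phi>" and z: "\<phi> ?z = 1"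
    and 0: "\<And>x. x \<in> U \<Longrightarrow> \<phi> x = 0"
    using separating_functional[OF vs U] by blast
  interpret \<phi>: Vector_Spaces.linear sc "(*)" \<phi> by fact
  define P where "P = (\<Sum>m\<in>S. monom (\<phi> (y m)) (e m)) - (\<Sum>m\<in>S'. monom (\<phi> (y' m)) (e' m))"
  have root: "poly P t = 0" if "t \<noteq> 0" for t
    using 0[OF mem[OF that]]
    by (simp add: P_def poly_sum poly_monom \<phi>.diff \<phi>.sum \<phi>.scale mult.commute)
  have "infinite (UNIV - {0 :: 'k})" using inf by simp
  moreover have "UNIV - {0} \<subseteq> {t. poly P t = 0}" using root by auto
  ultimately have "P = 0" using poly_roots_finite finite_subset by blast
  then have "coeff P n = 0" by simp
  moreover have "coeff P n = \<phi> ?z"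
    using fin by (simp add: P_def coeff_sum \<phi>.diff \<phi>.sum sum.inter_filter \<phi>.zero
        if_distrib[of \<phi>] cong: if_cong)
  ultimately show False using z by simp
qed

lemma coefficients_eq:
  fixes sc :: "'k::field \<Rightarrow> 'v::ab_group_add \<Rightarrow> 'v"
  assumes inf: "infinite (UNIV :: 'k set)" and vs: "vector_space sc"
    and fin: "finite S" "finite S'"
    and eq: "\<And>t. t \<noteq> 0 \<Longrightarrow> (\<Sum>m\<in>S. sc (t ^ e m) (y m)) = (\<Sum>m\<in>S'. sc (t ^ e' m) (y' m))"
  shows "(\<Sum>m | m \<in> S \<and> e m = n. y m) = (\<Sum>m | m \<in> S' \<and> e' m = n. y' m)"
proof -
  interpret vector_space sc by fact
  have "(\<Sum>m | m \<in> S \<and> e m = n. y m) - (\<Sum>m | m \<in> S' \<and> e' m = n. y' m) \<in> {0}"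
    by (rule coefficients_mem[OF inf vs _ fin]) (use eq in auto)
  then show ?thesis by simp
qed

lemma coefficients_eq_atMost:
  fixes sc :: "'k::field \<Rightarrow> 'v::ab_group_add \<Rightarrow> 'v"
  assumes inf: "infinite (UNIV :: 'k set)" and vs: "vector_space sc"
    and eq: "\<And>t. t \<noteq> 0 \<Longrightarrow> (\<Sum>d\<le>N. sc (t ^ d) (y d)) = (\<Sum>d\<le>N. sc (t ^ d) (y' d))"
    and "n \<le> N"
  shows "y n = y' n"
proof -
  have "{d. d \<in> {..N} \<and> d = n} = {n}" using assms(4) by auto
  then show ?thesis
    using coefficients_eq[OF inf vs _ _ eq, where n = n] by simp
qed

lemma power_eq_imp_exponent_eq:
  assumes "infinite (UNIV :: 'k::field set)" and "\<And>t :: 'k. t \<noteq> 0 \<Longrightarrow> t ^ c = t ^ d"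
  shows "c = d"
proof (rule ccontr)
  assume "c \<noteq> d"
  have "(\<Sum>m | m \<in> {c} \<and> m = c. 1 :: 'k) = (\<Sum>m | m \<in> {d} \<and> m = c. 1)"
    by (rule coefficients_eq[OF assms(1) vector_space_mult]) (use assms(2) in auto)
  moreover have "{m. m \<in> {c} \<and> m = c} = {c}" "{m. m \<in> {d} \<and> m = c} = {}"
    using \<open>c \<noteq> d\<close> by auto
  ultimately show False by (simp only:) simp
qed

section \<open>Polynomial maps on two by two matrices\<close>

text \<open>\<open>(\<alpha>, \<beta>, \<gamma>, \<delta>)\<close> stands for the matrix with rows \<open>(\<alpha>, \<beta>)\<close> and \<open>(\<gamma>, \<delta>)\<close>. Its first column
  is the image of the first basis vector.\<close>

type_synonym 'k mat2 = "'k \<times> 'k \<times> 'k \<times> 'k"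

fun monomial2 :: "nat \<times> nat \<times> nat \<times> nat \<Rightarrow> 'k::field mat2 \<Rightarrow> 'k" where
  "monomial2 (e\<^sub>1, e\<^sub>2, e\<^sub>3, e\<^sub>4) (\<alpha>, \<beta>, \<gamma>, \<delta>) = \<alpha> ^ e\<^sub>1 * \<beta> ^ e\<^sub>2 * \<gamma> ^ e\<^sub>3 * \<delta> ^ e\<^sub>4"

inductive polynomial_map :: "('k::field \<Rightarrow> 'v::ab_group_add \<Rightarrow> 'v) \<Rightarrow> ('k mat2 \<Rightarrow> 'v) \<Rightarrow> bool"
  for sc where
  monomial: "polynomial_map sc (\<lambda>M. sc (monomial2 e M) x)"
| add: "polynomial_map sc F \<Longrightarrow> polynomial_map sc G \<Longrightarrow> polynomial_map sc (\<lambda>M. F M + G M)"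

lemma monomial2_mult:
  "monomial2 (e\<^sub>1, e\<^sub>2, e\<^sub>3, e\<^sub>4) M * monomial2 (f\<^sub>1, f\<^sub>2, f\<^sub>3, f\<^sub>4) M
    = monomial2 (e\<^sub>1 + f\<^sub>1, e\<^sub>2 + f\<^sub>2, e\<^sub>3 + f\<^sub>3, e\<^sub>4 + f\<^sub>4) M"
  by (cases M) (simp add: power_add algebra_simps)

lemma polynomial_map_const:
  assumes "vector_space sc"
  shows "polynomial_map sc (\<lambda>_. x)"
proof -
  interpret vector_space sc by fact
  have "monomial2 (0, 0, 0, 0) M = 1" for M :: "'a mat2" by (cases M) simp
  with polynomial_map.monomial[of sc "(0, 0, 0, 0)" x] show ?thesis by simp
qed

lemma polynomial_map_sum:
  assumes "vector_space sc" and "\<And>i. i \<in> A \<Longrightarrow> polynomial_map sc (F i)"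
  shows "polynomial_map sc (\<lambda>M. \<Sum>i\<in>A. F i M)"
  using assms(2)
  by (induction A rule: infinite_finite_induct)
    (auto intro: polynomial_map.add polynomial_map_const[OF assms(1)])

lemma polynomial_map_linear:
  assumes "Vector_Spaces.linear sc sd f" and "polynomial_map sc F"
  shows "polynomial_map sd (\<lambda>M. f (F M))"
proof -
  interpret f: Vector_Spaces.linear sc sd f by fact
  show ?thesis using assms(2)
    by induction (auto simp: f.add f.scale intro: polynomial_map.intros)
qed

lemma polynomial_map_bilinear:
  assumes b: "bilinear_map sV sW sT b" and F: "polynomial_map sV F" and G: "polynomial_map sW G"
  shows "polynomial_map sT (\<lambda>M. b (F M) (G M))"
  using F
proof induction
  case (monomial e x)
  have L: "Vector_Spaces.linear sV sT (\<lambda>v. b v w)" "Vector_Spaces.linear sW sT (b v)" for v w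
    using b by (auto simp: bilinear_map_def)
  then interpret T: vector_space sT by (auto simp: Vector_Spaces.linear_iff)
  show ?case using G
  proof induction
    case (monomial f y)
    have "b (sV (monomial2 e M) x) (sW (monomial2 f M) y) = sT (monomial2 e M * monomial2 f M) (b x y)" for M
      using L by (auto simp: Vector_Spaces.linear_iff)
    then show ?case
      by (cases e; cases f) (auto simp only: monomial2_mult intro: polynomial_map.monomial)
  next
    case (add F G)
    have "b x (y + z) = b x y + b x z" for x y z
      using L by (auto simp: Vector_Spaces.linear_iff)
    with add show ?case by (auto intro: polynomial_map.add)
  qed
next
  case (add F F')
  have "b (x + y) z = b x z + b y z" for x y z
    using b by (auto simp: Vector_Spaces.linear_iff bilinear_map_def)
  with add show ?case by (auto intro: polynomial_map.add)
qed

text \<open>Collecting terms, each monomial occurs with a single coefficient vector, so that the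
  monomials can be sorted by their exponents.\<close>

lemma polynomial_map_normal_form:
  assumes vs: "vector_space sc" and "polynomial_map sc F"
  obtains S X where "finite S" "\<And>M. F M = (\<Sum>e\<in>S. sc (monomial2 e M) (X e))"
proof -
  interpret vector_space sc by fact
  have "\<exists>S X. finite S \<and> (\<forall>M. F M = (\<Sum>e\<in>S. sc (monomial2 e M) (X e)))"
    using assms(2)
  proof induction
    case (monomial e x)
    show ?case by (rule exI[of _ "{e}"], rule exI[of _ "\<lambda>_. x"]) simp
  next
    case (add F G)
    then obtain S X T Y where *: "finite S" "\<forall>M. F M = (\<Sum>e\<in>S. sc (monomial2 e M) (X e))"
      "finite T" "\<forall>M. G M = (\<Sum>e\<in>T. sc (monomial2 e M) (Y e))" by blast
    define Z where "Z e = (if e \<in> S then X e else 0) + (if e \<in> T then Y e else 0)" for e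
    have "F M = (\<Sum>e\<in>S \<union> T. sc (monomial2 e M) (if e \<in> S then X e else 0))" for M
      using * by (subst *(2)[rule_format], intro sum.mono_neutral_cong_left) auto
    moreover have "G M = (\<Sum>e\<in>S \<union> T. sc (monomial2 e M) (if e \<in> T then Y e else 0))" for M
      using * by (subst *(4)[rule_format], intro sum.mono_neutral_cong_left) auto
    ultimately have "F M + G M = (\<Sum>e\<in>S \<union> T. sc (monomial2 e M) (Z e))" for M
      by (simp add: Z_def scale_right_distrib sum.distrib)
    then show ?case using * by (intro exI[of _ "S \<union> T"] exI[of _ Z]) auto
  qed
  then show thesis using that by blast
qed

section \<open>Block matrices in the general linear group\<close>

fun block :: "nat \<Rightarrow> nat \<Rightarrow> 'k::field mat2 \<Rightarrow> 'k gl" where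
  "block j k (\<alpha>, \<beta>, \<gamma>, \<delta>) x = x
     + Poly_Mapping.single j ((\<alpha> - 1) * Poly_Mapping.lookup x j + \<beta> * Poly_Mapping.lookup x k)
     + Poly_Mapping.single k (\<gamma> * Poly_Mapping.lookup x j + (\<delta> - 1) * Poly_Mapping.lookup x k)"

lemma lookup_block:
  assumes "j \<noteq> k"
  shows "Poly_Mapping.lookup (block j k (\<alpha>, \<beta>, \<gamma>, \<delta>) x) l =
    (if l = j then \<alpha> * Poly_Mapping.lookup x j + \<beta> * Poly_Mapping.lookup x k
     else if l = k then \<gamma> * Poly_Mapping.lookup x j + \<delta> * Poly_Mapping.lookup x k
     else Poly_Mapping.lookup x l)"
  using assms by (auto simp: lookup_add lookup_single when_def algebra_simps)

declare block.simps [simp del]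

lemma linear_block:
  assumes "j \<noteq> k"
  shows "Vector_Spaces.linear fscale fscale (block j k M)"
proof -
  obtain \<alpha> \<beta> \<gamma> \<delta> where M: "M = (\<alpha>, \<beta>, \<gamma>, \<delta>)" by (cases M)
  show ?thesis unfolding Vector_Spaces.linear_iff M
    by (auto intro!: poly_mapping_eqI vector_space_fscale
      simp: lookup_block[OF assms] lookup_add algebra_simps)
qed

lemma block_comp:
  assumes "j \<noteq> k"
  shows "block j k (\<alpha>', \<beta>', \<gamma>', \<delta>') \<circ> block j k (\<alpha>, \<beta>, \<gamma>, \<delta>) =
    block j k (\<alpha>' * \<alpha> + \<beta>' * \<gamma>, \<alpha>' * \<beta> + \<beta>' * \<delta>, \<gamma>' * \<alpha> + \<delta>' * \<gamma>, \<gamma>' * \<beta> + \<delta>' * \<delta>)"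
  using assms by (intro ext poly_mapping_eqI) (auto simp: lookup_block algebra_simps)

lemma block_id:
  assumes "j \<noteq> k"
  shows "block j k (1, 0, 0, 1) = id"
  using assms by (intro ext poly_mapping_eqI) (auto simp: lookup_block)

lemma block_in_GL:
  assumes "j \<noteq> k" and det: "\<alpha> * \<delta> - \<beta> * \<gamma> \<noteq> 0"
  shows "block j k (\<alpha>, \<beta>, \<gamma>, \<delta>) \<in> GL"
proof -
  define D where "D = \<alpha> * \<delta> - \<beta> * \<gamma>"
  have "D \<noteq> 0" using det by (simp add: D_def)
  have e: "\<alpha> * \<delta> / D - \<beta> * \<gamma> / D = 1"
    using \<open>D \<noteq> 0\<close> by (simp add: D_def diff_divide_distrib [symmetric])
  let ?g = "block j k (\<alpha>, \<beta>, \<gamma>, \<delta>)" and ?h = "block j k (\<delta> / D, - \<beta> / D, - \<gamma> / D, \<alpha> / D)"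
  have "?g \<circ> ?h = id" "?h \<circ> ?g = id"
    using e by (simp_all add: block_comp[OF assms(1)] block_id[OF assms(1), symmetric] algebra_simps)
  then have "bij ?g" by (rule o_bij[rotated])
  moreover have "{i. ?g (basis_vec i) \<noteq> basis_vec i} \<subseteq> {j, k}"
    using assms(1) by (auto intro!: poly_mapping_eqI simp: lookup_block lookup_single when_def)
  then have "finite {i. ?g (basis_vec i) \<noteq> basis_vec i}" by (rule finite_subset) simp
  ultimately show ?thesis by (simp add: GL_def linear_block[OF assms(1)])
qed

lemma lookup_diag [simp]: "Poly_Mapping.lookup (diag t x) l = t l * Poly_Mapping.lookup x l"
  by (simp add: diag_def mapp.rep_eq when_def in_keys_iff)

lemma diag_in_GL:
  assumes "t \<in> torus"
  shows "diag t \<in> GL"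
proof -
  have t: "t l \<noteq> 0" for l using assms by (simp add: torus_def)
  have "diag t \<circ> diag (\<lambda>l. 1 / t l) = id" "diag (\<lambda>l. 1 / t l) \<circ> diag t = id"
    by (auto intro!: ext poly_mapping_eqI simp: t)
  then have "bij (diag t)" by (rule o_bij[rotated])
  moreover have "Vector_Spaces.linear fscale fscale (diag t)"
    unfolding Vector_Spaces.linear_iff
    by (auto intro!: poly_mapping_eqI vector_space_fscale simp: lookup_add algebra_simps)
  moreover have "{i. diag t (basis_vec i) \<noteq> basis_vec i} \<subseteq> {i. t i \<noteq> 1}"
    by (auto intro!: poly_mapping_eqI simp: lookup_single when_def split: if_splits)
  then have "finite {i. diag t (basis_vec i) \<noteq> basis_vec i}"
    using assms by (auto simp: torus_def intro: finite_subset)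
  ultimately show ?thesis by (simp add: GL_def)
qed

text \<open>The entries of the torus element at \<open>j\<close> and \<open>k\<close> are absorbed into the block. What is left
  commutes with the block, which is why the weights outside \<open>{j, k}\<close> are unaffected by it.\<close>

lemma diag_block:
  assumes "j \<noteq> k"
  shows "diag t \<circ> block j k (\<alpha>, \<beta>, \<gamma>, \<delta>)
    = block j k (t j * \<alpha>, t j * \<beta>, t k * \<gamma>, t k * \<delta>) \<circ> diag (t(j := 1, k := 1))"
  using assms by (intro ext poly_mapping_eqI) (auto simp: lookup_block algebra_simps)

lemma diag_eq_block:
  assumes "j \<noteq> k"
  shows "diag ((\<lambda>_. 1)(j := a, k := b)) = block j k (a, 0, 0, b)"
  using assms by (intro ext poly_mapping_eqI) (auto simp: lookup_block)

section \<open>Polynomial representations are polynomial on blocks\<close>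

text \<open>All that the argument uses of polynomial representations: matrices differing from the
  identity only in the block \<open>{j, k}\<close> act by polynomials in their entries. Unlike being a
  subquotient of tensor powers, this passes to tensor products at once.\<close>

locale gl_polynomial_action =
  fixes sc :: "'k::field \<Rightarrow> 'v::ab_group_add \<Rightarrow> 'v" and \<rho> :: "'k gl \<Rightarrow> 'v \<Rightarrow> 'v"
  assumes vs: "vector_space sc"
    and linear_act: "g \<in> GL \<Longrightarrow> Vector_Spaces.linear sc sc (\<rho> g)"
    and act_id: "\<rho> id x = x"
    and act_comp: "g \<in> GL \<Longrightarrow> h \<in> GL \<Longrightarrow> \<rho> (g \<circ> h) x = \<rho> g (\<rho> h x)"
    and act_block: "j \<noteq> k \<Longrightarrow>
      \<exists>F. polynomial_map sc F \<and> (\<forall>M. block j k M \<in> GL \<longrightarrow> \<rho> (block j k M) x = F M)"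

text \<open>The map \<open>f \<mapsto> e\<^sub>i \<otimes> f\<close>.\<close>

definition prepend :: "nat \<Rightarrow> (nat list \<Rightarrow>\<^sub>0 'k::field) \<Rightarrow> (nat list \<Rightarrow>\<^sub>0 'k)" where
  "prepend i f = (\<Sum>w\<in>Poly_Mapping.keys f. Poly_Mapping.single (i # w) (Poly_Mapping.lookup f w))"

lemma lookup_prepend:
  "Poly_Mapping.lookup (prepend i f) w =
    (case w of [] \<Rightarrow> 0 | l # w' \<Rightarrow> if l = i then Poly_Mapping.lookup f w' else 0)"
proof (cases w)
  case (Cons l w')
  have "Poly_Mapping.lookup (prepend i f) (l # w')
    = (\<Sum>v\<in>Poly_Mapping.keys f. if v = w' then (if l = i then Poly_Mapping.lookup f w' else 0) else 0)"
    unfolding prepend_def lookup_sum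
    by (rule sum.cong) (auto simp: lookup_single when_def)
  also have "\<dots> = (if l = i then Poly_Mapping.lookup f w' else 0)"
    by (auto simp: in_keys_iff)
  finally show ?thesis by (simp add: Cons)
qed (simp add: prepend_def lookup_sum lookup_single)

lemma linear_prepend: "Vector_Spaces.linear fscale fscale (prepend i)"
  unfolding Vector_Spaces.linear_iff
  by (auto intro!: poly_mapping_eqI vector_space_fscale
    simp: lookup_prepend lookup_add split: list.split)

lemma pure_tensor_Cons:
  assumes "finite F" and "Poly_Mapping.keys x \<subseteq> F"
  shows "pure_tensor (x # xs)
    = (\<Sum>i\<in>F. fscale (Poly_Mapping.lookup x i) (prepend i (pure_tensor xs)))"
proof -
  have "pure_tensor (x # xs)
    = (\<Sum>i\<in>Poly_Mapping.keys x. fscale (Poly_Mapping.lookup x i) (prepend i (pure_tensor xs)))"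
    by (auto intro!: sum.cong poly_mapping_eqI sum.cong
      simp: prepend_def lookup_sum lookup_single when_def sum_distrib_left)
  also have "\<dots> = (\<Sum>i\<in>F. fscale (Poly_Mapping.lookup x i) (prepend i (pure_tensor xs)))"
    using assms by (intro sum.mono_neutral_left) (auto intro!: poly_mapping_eqI simp: in_keys_iff)
  finally show ?thesis .
qed

lemma polynomial_map_block_entry:
  assumes "j \<noteq> k"
  shows "polynomial_map (*) (\<lambda>M. Poly_Mapping.lookup (block j k M (basis_vec i)) l)"
proof -
  note const = polynomial_map_const[OF vector_space_mult]
  have var: "polynomial_map (*) (\<lambda>(\<alpha>, \<beta>, \<gamma>, \<delta>). \<alpha> :: 'a)" "polynomial_map (*) (\<lambda>(\<alpha>, \<beta>, \<gamma>, \<delta>). \<beta> :: 'a)"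
    "polynomial_map (*) (\<lambda>(\<alpha>, \<beta>, \<gamma>, \<delta>). \<gamma> :: 'a)" "polynomial_map (*) (\<lambda>(\<alpha>, \<beta>, \<gamma>, \<delta>). \<delta> :: 'a)"
  proof -
    have "(\<lambda>(\<alpha>, \<beta>, \<gamma>, \<delta>). \<alpha>) = (\<lambda>M. monomial2 (1, 0, 0, 0) M * (1 :: 'a))"
      "(\<lambda>(\<alpha>, \<beta>, \<gamma>, \<delta>). \<beta>) = (\<lambda>M. monomial2 (0, 1, 0, 0) M * (1 :: 'a))"
      "(\<lambda>(\<alpha>, \<beta>, \<gamma>, \<delta>). \<gamma>) = (\<lambda>M. monomial2 (0, 0, 1, 0) M * (1 :: 'a))"
      "(\<lambda>(\<alpha>, \<beta>, \<gamma>, \<delta>). \<delta>) = (\<lambda>M. monomial2 (0, 0, 0, 1) M * (1 :: 'a))"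
      by auto
    then show "polynomial_map (*) (\<lambda>(\<alpha>, \<beta>, \<gamma>, \<delta>). \<alpha> :: 'a)"
      "polynomial_map (*) (\<lambda>(\<alpha>, \<beta>, \<gamma>, \<delta>). \<beta> :: 'a)"
      "polynomial_map (*) (\<lambda>(\<alpha>, \<beta>, \<gamma>, \<delta>). \<gamma> :: 'a)"
      "polynomial_map (*) (\<lambda>(\<alpha>, \<beta>, \<gamma>, \<delta>). \<delta> :: 'a)"
      by (simp_all only: polynomial_map.monomial)
  qed
  have "(\<lambda>M. Poly_Mapping.lookup (block j k M (basis_vec i)) l) =
    (if l = j then (if i = j then (\<lambda>(\<alpha>, \<beta>, \<gamma>, \<delta>). \<alpha>) else if i = k then (\<lambda>(\<alpha>, \<beta>, \<gamma>, \<delta>). \<beta>) else (\<lambda>_. 0))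
     else if l = k then (if i = j then (\<lambda>(\<alpha>, \<beta>, \<gamma>, \<delta>). \<gamma>) else if i = k then (\<lambda>(\<alpha>, \<beta>, \<gamma>, \<delta>). \<delta>) else (\<lambda>_. 0))
     else (\<lambda>_. if i = l then 1 else 0 :: 'a))"
    using assms by (auto simp: lookup_block lookup_single when_def)
  then show ?thesis using var const by auto
qed

lemma polynomial_map_pure_tensor:
  assumes "j \<noteq> k"
  shows "polynomial_map fscale (\<lambda>M. pure_tensor (map (\<lambda>i. block j k M (basis_vec i)) w))"
proof (induction w)
  case Nil
  show ?case by (simp add: polynomial_map_const vector_space_fscale)
next
  case (Cons i w)
  let ?F = "{i, j, k}"
  have keys: "Poly_Mapping.keys (block j k M (basis_vec i)) \<subseteq> ?F" for M :: "'a mat2"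
    using assms by (cases M) (auto simp: in_keys_iff lookup_block lookup_single when_def split: if_splits)
  have eq: "pure_tensor (map (\<lambda>i. block j k M (basis_vec i)) (i # w)) = (\<Sum>l\<in>?F.
      fscale (Poly_Mapping.lookup (block j k M (basis_vec i)) l)
        (prepend l (pure_tensor (map (\<lambda>i. block j k M (basis_vec i)) w))))" for M :: "'a mat2"
    unfolding list.map by (rule pure_tensor_Cons) (simp, rule keys)
  have bil: "bilinear_map (*) fscale fscale (fscale :: 'a \<Rightarrow> (nat list \<Rightarrow>\<^sub>0 'a) \<Rightarrow> _)"
    unfolding bilinear_map_def Vector_Spaces.linear_iff
    by (auto intro!: poly_mapping_eqI vector_space_fscale vector_space_mult
      simp: lookup_add algebra_simps)
  show ?case unfolding eq
    by (rule polynomial_map_sum[OF vector_space_fscale], rule polynomial_map_bilinear[OF bil],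
      rule polynomial_map_block_entry[OF assms], rule polynomial_map_linear[OF linear_prepend Cons])
qed

lemma polynomial_map_sum_act:
  assumes "j \<noteq> k"
  shows "polynomial_map sum_scale (\<lambda>M. sum_act (block j k M) x)"
proof -
  have "polynomial_map fscale (\<lambda>M. tensor_act (block j k M) f)" for f :: "nat list \<Rightarrow>\<^sub>0 'a"
  proof -
    have "Vector_Spaces.linear fscale fscale (fscale c :: (nat list \<Rightarrow>\<^sub>0 'a) \<Rightarrow> _)" for c
      unfolding Vector_Spaces.linear_iff
      by (auto intro!: poly_mapping_eqI vector_space_fscale simp: lookup_add algebra_simps)
    then show ?thesis unfolding tensor_act_def
      using polynomial_map_linear polynomial_map_pure_tensor[OF assms]
      by (intro polynomial_map_sum[OF vector_space_fscale]) blast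
  qed
  note act = this
  have lin: "Vector_Spaces.linear fscale sum_scale
      (Poly_Mapping.single i :: (nat list \<Rightarrow>\<^sub>0 'a) \<Rightarrow> _)" for i :: 'b
    unfolding Vector_Spaces.linear_iff
    by (auto intro!: poly_mapping_eqI vector_space_fscale vector_space_sum_scale
      simp: lookup_add lookup_single when_def)
  have eq: "sum_act g x
    = (\<Sum>i\<in>Poly_Mapping.keys x. Poly_Mapping.single i (tensor_act g (Poly_Mapping.lookup x i)))" for g
    by (rule poly_mapping_eqI)
      (auto simp: sum_act_def map.rep_eq lookup_sum lookup_single when_def in_keys_iff)
  show ?thesis unfolding eq
    by (rule polynomial_map_sum[OF vector_space_sum_scale], rule polynomial_map_linear[OF lin act])
qed

lemma linear_extension:
  assumes vs: "vector_space (s1 :: 'k::field \<Rightarrow> 'v::ab_group_add \<Rightarrow> 'v)"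
    "vector_space (s2 :: 'k::field \<Rightarrow> 'w::ab_group_add \<Rightarrow> 'w)"
    and A: "module.subspace s1 A"
    and add: "\<And>x y. x \<in> A \<Longrightarrow> y \<in> A \<Longrightarrow> q (x + y) = q x + q y"
    and scale: "\<And>c x. x \<in> A \<Longrightarrow> q (s1 c x) = s2 c (q x)"
  obtains q' where "Vector_Spaces.linear s1 s2 q'" "\<And>x. x \<in> A \<Longrightarrow> q' x = q x"
proof -
  interpret V: vector_space s1 by fact
  interpret W: vector_space s2 by fact
  interpret P: vector_space_pair s1 s2 ..
  obtain B where B: "B \<subseteq> A" "V.independent B" "A \<subseteq> V.span B"
    using V.maximal_independent_subset by blast
  obtain q' where lin: "Vector_Spaces.linear s1 s2 q'" and q': "\<forall>x\<in>B. q' x = q x"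
    using P.linear_independent_extend[OF B(2), of q] by blast
  interpret q': Vector_Spaces.linear s1 s2 q' by fact
  have 0: "q 0 = 0"
    using scale[of 0 0] V.subspace_0[OF A] by simp
  have "x \<in> A \<and> q' x = q x" if "x \<in> V.span B" for x
    using that
  proof (induction rule: V.span_induct_alt)
    case base
    show ?case using 0 V.subspace_0[OF A] by (simp add: q'.zero)
  next
    case (step c x y)
    then have "x \<in> A" using B(1) by auto
    then have "s1 c x \<in> A" by (rule V.subspace_scale[OF A])
    then show ?case
      using step q' \<open>x \<in> A\<close> V.subspace_add[OF A] by (simp add: q'.add q'.scale add scale)
  qed
  then show thesis using that[OF lin] B(3) by blast
qed

text \<open>Extending the quotient map linearly to the whole sum of tensor powers makes the image of
  each coefficient of the action on tensors meaningful, without first showing that the coefficients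
  lie in the subrepresentation \<open>A\<close>.\<close>

lemma polynomial_rep_imp_gl_polynomial_action:
  assumes "polynomial_rep I d sc \<rho>"
  shows "gl_polynomial_action sc \<rho>"
proof -
  have rep: "gl_rep sc \<rho>" using assms by (simp add: polynomial_rep_def)
  then have vs: "vector_space sc" by (simp add: gl_rep_def)
  obtain A q where "A \<subseteq> tensor_sum I d" and A: "subrep sum_scale sum_act A"
    and add: "\<forall>x\<in>A. \<forall>y\<in>A. q (x + y) = q x + q y"
    and scale: "\<forall>c. \<forall>x\<in>A. q (sum_scale c x) = sc c (q x)"
    and equivariant: "\<forall>g\<in>GL. \<forall>x\<in>A. q (sum_act g x) = \<rho> g (q x)"
    and surj: "q ` A = UNIV"
    using assms unfolding polynomial_rep_def by blast
  have sub: "module.subspace sum_scale A" using A by (simp add: subrep_def)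
  obtain q' where q': "Vector_Spaces.linear sum_scale sc q'" "\<And>x. x \<in> A \<Longrightarrow> q' x = q x"
    using linear_extension[of sum_scale sc A q, OF vector_space_sum_scale vs sub] add scale by blast
  show ?thesis
  proof (rule gl_polynomial_action.intro)
    fix j k :: nat and x assume "j \<noteq> k"
    obtain y where y: "y \<in> A" "x = q y" using surj by blast
    have "\<rho> (block j k M) x = q' (sum_act (block j k M) y)" if "block j k M \<in> GL" for M
      using that y A by (simp add: q'(2) equivariant subrep_def)
    moreover have "polynomial_map sc (\<lambda>M. q' (sum_act (block j k M) y))"
      by (rule polynomial_map_linear[OF q'(1) polynomial_map_sum_act[OF \<open>j \<noteq> k\<close>]])
    ultimately show "\<exists>F. polynomial_map sc F \<and>
        (\<forall>M. block j k M \<in> GL \<longrightarrow> \<rho> (block j k M) x = F M)"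
      by blast
  qed (use rep in \<open>auto simp: gl_rep_def\<close>)
qed

lemma tensor_induct [consumes 1, case_names tens add]:
  assumes tp: "tensor_product sV sW sT tens"
    and tens: "\<And>v w. P (tens v w)" and add: "\<And>x y. P x \<Longrightarrow> P y \<Longrightarrow> P (x + y)"
  shows "P x"
proof -
  have bil: "bilinear_map sV sW sT tens" by (rule tensor_product_bilinear[OF tp])
  have s: "sT c (tens v w) = tens (sV c v) w" for c v w
    using bil by (auto simp: bilinear_map_def Vector_Spaces.linear_iff)
  have "0 = tens 0 0"
    using bil module_hom.zero[of sV sT "\<lambda>v. tens v 0"]
    by (auto simp: bilinear_map_def Vector_Spaces.linear_def module_hom_def)
  then have P0: "P 0" using tens by metis
  obtain f where f: "x = eval_tensors sT tens f"
    using tp unfolding tensor_product_def surj_def by blast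
  have "P (\<Sum>z\<in>Z. sT (c z) (tens (fst z) (snd z)))" for Z and c :: "'b \<times> 'c \<Rightarrow> 'a"
    by (induction Z rule: infinite_finite_induct) (auto simp: P0 s intro: add tens)
  then show ?thesis unfolding f eval_tensors_def case_prod_beta by simp
qed

lemma tensor_product_gl_polynomial_action:
  assumes "gl_polynomial_action sV \<rho>V" "gl_polynomial_action sW \<rho>W"
    and T: "tensor_product_rep sV \<rho>V sW \<rho>W sT \<rho>T tens"
  shows "gl_polynomial_action sT \<rho>T"
proof -
  interpret V: gl_polynomial_action sV \<rho>V by fact
  interpret W: gl_polynomial_action sW \<rho>W by fact
  have tp: "tensor_product sV sW sT tens"
    and lin: "\<And>g. g \<in> GL \<Longrightarrow> Vector_Spaces.linear sT sT (\<rho>T g)"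
    and act: "\<And>g v w. g \<in> GL \<Longrightarrow> \<rho>T g (tens v w) = tens (\<rho>V g v) (\<rho>W g w)"
    using T by (auto simp: tensor_product_rep_def)
  have bil: "bilinear_map sV sW sT tens" by (rule tensor_product_bilinear[OF tp])
  have add: "\<rho>T g (x + y) = \<rho>T g x + \<rho>T g y" if "g \<in> GL" for g x y
    using lin[OF that] by (simp add: Vector_Spaces.linear_iff)
  have comp: "g \<circ> h \<in> GL" if "g \<in> GL" "h \<in> GL" for g h :: "'a gl"
  proof -
    have "{i. (g \<circ> h) (basis_vec i) \<noteq> basis_vec i}
      \<subseteq> {i. g (basis_vec i) \<noteq> basis_vec i} \<union> {i. h (basis_vec i) \<noteq> basis_vec i}"
      by auto
    then have "finite {i. (g \<circ> h) (basis_vec i) \<noteq> basis_vec i}"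
      using that by (auto simp: GL_def intro: finite_subset)
    then show ?thesis using that
      by (auto simp: GL_def bij_comp Vector_Spaces.linear_iff)
  qed
  have id: "id \<in> (GL :: 'a gl set)"
    unfolding block_id[OF zero_neq_one, symmetric] by (rule block_in_GL) auto
  show ?thesis
  proof (rule gl_polynomial_action.intro)
    show "vector_space sT" using tp by (simp add: tensor_product_def)
    show "Vector_Spaces.linear sT sT (\<rho>T g)" if "g \<in> GL" for g by (rule lin[OF that])
    show "\<rho>T id x = x" for x
      using tp by (induction x rule: tensor_induct) (simp_all only: act[OF id] add[OF id] V.act_id W.act_id)
    show "\<rho>T (g \<circ> h) x = \<rho>T g (\<rho>T h x)" if "g \<in> GL" "h \<in> GL" for g h x
      using tp by (induction x rule: tensor_induct)
        (simp_all only: act add comp that V.act_comp W.act_comp)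
    fix j k :: nat and x assume jk: "j \<noteq> k"
    show "\<exists>F. polynomial_map sT F \<and> (\<forall>M. block j k M \<in> GL \<longrightarrow> \<rho>T (block j k M) x = F M)"
      using tp
    proof (induction x rule: tensor_induct)
      case (tens v w)
      obtain F G where "polynomial_map sV F" "polynomial_map sW G"
        "\<forall>M. block j k M \<in> GL \<longrightarrow> \<rho>V (block j k M) v = F M"
        "\<forall>M. block j k M \<in> GL \<longrightarrow> \<rho>W (block j k M) w = G M"
        using V.act_block[OF jk] W.act_block[OF jk] by blast
      then show ?case
        by (intro exI[of _ "\<lambda>M. tens (F M) (G M)"]) (auto simp: act polynomial_map_bilinear[OF bil])
    next
      case (add x y)
      then obtain F G where "polynomial_map sT F" "polynomial_map sT G"
        "\<forall>M. block j k M \<in> GL \<longrightarrow> \<rho>T (block j k M) x = F M"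
        "\<forall>M. block j k M \<in> GL \<longrightarrow> \<rho>T (block j k M) y = G M" by blast
      then show ?case
        by (intro exI[of _ "\<lambda>M. F M + G M"])
          (auto simp: \<open>\<And>g x y. g \<in> GL \<Longrightarrow> \<rho>T g (x + y) = \<rho>T g x + \<rho>T g y\<close> intro: polynomial_map.add)
    qed
  qed
qed

section \<open>Splitting one entry of a weight\<close>

definition weight_char :: "weight \<Rightarrow> (nat \<Rightarrow> 'k::field) \<Rightarrow> 'k" where
  "weight_char \<mu> t = (\<Prod>i\<in>Poly_Mapping.keys \<mu>. t i ^ Poly_Mapping.lookup \<mu> i)"

definition move_weight :: "nat \<Rightarrow> nat \<Rightarrow> nat \<Rightarrow> weight \<Rightarrow> weight" where
  "move_weight j k d \<mu> = Poly_Mapping.update j (Poly_Mapping.lookup \<mu> j - d) (Poly_Mapping.update k d \<mu>)"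

lemma lookup_move_weight:
  "Poly_Mapping.lookup (move_weight j k d \<mu>) l =
    (if l = j then Poly_Mapping.lookup \<mu> j - d else if l = k then d else Poly_Mapping.lookup \<mu> l)"
  by (auto simp: move_weight_def lookup_update)

lemma weight_char_superset:
  assumes "finite F" and "Poly_Mapping.keys \<mu> \<subseteq> F"
  shows "weight_char \<mu> t = (\<Prod>i\<in>F. t i ^ Poly_Mapping.lookup \<mu> i)"
  unfolding weight_char_def using assms
  by (intro prod.mono_neutral_left) (auto simp: in_keys_iff)

lemma weight_char_fun_upd:
  "weight_char \<mu> ((\<lambda>_. 1)(j := t)) = t ^ Poly_Mapping.lookup \<mu> j"
proof -
  have "weight_char \<mu> ((\<lambda>_. 1)(j := t))
    = (\<Prod>i\<in>insert j (Poly_Mapping.keys \<mu>). ((\<lambda>_. 1)(j := t)) i ^ Poly_Mapping.lookup \<mu> i)"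
    by (rule weight_char_superset) auto
  also have "\<dots> = (\<Prod>i\<in>insert j (Poly_Mapping.keys \<mu>). if i = j then t ^ Poly_Mapping.lookup \<mu> j else 1)"
    by (rule prod.cong) auto
  finally show ?thesis by simp
qed

lemma weight_char_fun_upd2:
  assumes "j \<noteq> k"
  shows "weight_char \<mu> ((\<lambda>_. 1)(j := t, k := r))
    = t ^ Poly_Mapping.lookup \<mu> j * r ^ Poly_Mapping.lookup \<mu> k"
proof -
  let ?F = "insert j (insert k (Poly_Mapping.keys \<mu>))"
  have "weight_char \<mu> ((\<lambda>_. 1)(j := t, k := r))
    = (\<Prod>i\<in>?F. ((\<lambda>_. 1)(j := t, k := r)) i ^ Poly_Mapping.lookup \<mu> i)"
    by (rule weight_char_superset) auto
  also have "\<dots> = (\<Prod>i\<in>?F. (if i = j then t ^ Poly_Mapping.lookup \<mu> j else 1)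
      * (if i = k then r ^ Poly_Mapping.lookup \<mu> k else 1))"
    using assms by (intro prod.cong) auto
  finally show ?thesis by (simp add: prod.distrib)
qed

text \<open>The right-hand side separates the part of the character that enters the block in
  \<open>diag_block\<close> from the part that is left on the right of the block there.\<close>

lemma weight_char_move_weight:
  assumes "j \<noteq> k" and "k \<notin> Poly_Mapping.keys \<mu>"
  shows "weight_char (move_weight j k d \<mu>) t =
    t j ^ (Poly_Mapping.lookup \<mu> j - d) * t k ^ d * weight_char \<mu> (t(j := 1, k := 1))"
proof -
  define G where "G = Poly_Mapping.keys \<mu> - {j, k}"
  have G: "finite G" "j \<notin> G" "k \<notin> G" by (auto simp: G_def)
  have F: "finite (insert j (insert k G))" using G by simp
  have k1: "Poly_Mapping.keys (move_weight j k d \<mu>) \<subseteq> insert j (insert k G)"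
    and k2: "Poly_Mapping.keys \<mu> \<subseteq> insert j (insert k G)"
    by (auto simp: G_def in_keys_iff lookup_move_weight split: if_splits)
  have "(\<Prod>i\<in>G. t i ^ Poly_Mapping.lookup (move_weight j k d \<mu>) i)
    = (\<Prod>i\<in>G. (t(j := 1, k := 1)) i ^ Poly_Mapping.lookup \<mu> i)"
    using G by (intro prod.cong) (auto simp: lookup_move_weight)
  then show ?thesis
    using G assms
    by (simp add: weight_char_superset[OF F k1] weight_char_superset[OF F k2]
      lookup_move_weight in_keys_iff)
qed

text \<open>The block acts on \<open>x\<close> through its first column alone, homogeneously of degree \<open>c\<close>. Here
  \<open>X d\<close> is the \<open>d\<close>-th divided power of the elementary matrix taking \<open>e\<^sub>j\<close> to \<open>e\<^sub>k\<close>, applied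
  to \<open>x\<close>; obtaining it as a coefficient avoids a division by \<open>d!\<close>.\<close>

definition column_expansion ::
  "('k::field \<Rightarrow> 'v::ab_group_add \<Rightarrow> 'v) \<Rightarrow> ('k gl \<Rightarrow> 'v \<Rightarrow> 'v) \<Rightarrow> nat \<Rightarrow> nat \<Rightarrow> nat \<Rightarrow> 'v \<Rightarrow> (nat \<Rightarrow> 'v) \<Rightarrow> bool"
where
  "column_expansion sc \<rho> j k c x X \<longleftrightarrow> (\<forall>\<alpha> \<beta> \<gamma> \<delta>. \<alpha> * \<delta> - \<beta> * \<gamma> \<noteq> 0 \<longrightarrow>
     \<rho> (block j k (\<alpha>, \<beta>, \<gamma>, \<delta>)) x = (\<Sum>d\<le>c. sc (\<alpha> ^ (c - d) * \<gamma> ^ d) (X d)))"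

locale gl_polynomial_action_infinite = gl_polynomial_action sc \<rho>
  for sc :: "'k::field \<Rightarrow> 'v::ab_group_add \<Rightarrow> 'v" and \<rho> :: "'k gl \<Rightarrow> 'v \<Rightarrow> 'v" +
  assumes infinite_field: "infinite (UNIV :: 'k set)"
begin

sublocale V: vector_space sc by (rule vs)

definition has_weight :: "weight \<Rightarrow> 'v \<Rightarrow> bool" where
  "has_weight \<mu> x \<longleftrightarrow> (\<forall>t\<in>torus. \<rho> (diag t) x = sc (weight_char \<mu> t) x)"

lemma weight_vector_iff: "weight_vector sc \<rho> \<mu> x \<longleftrightarrow> x \<noteq> 0 \<and> has_weight \<mu> x"
  by (auto simp: weight_vector_def has_weight_def weight_char_def)

text \<open>Multiplying the block on the right by a torus element scales its columns, while the weight of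
  \<open>x\<close> prescribes the effect on the result: degree \<open>c\<close> in the first column and degree \<open>0\<close> in the
  second. Comparison of coefficients discards all other monomials.\<close>

lemma column_expansion_exists:
  assumes jk: "j \<noteq> k" and x: "has_weight \<mu> x" and k: "k \<notin> Poly_Mapping.keys \<mu>"
  obtains X where "column_expansion sc \<rho> j k (Poly_Mapping.lookup \<mu> j) x X"
proof -
  define c where "c = Poly_Mapping.lookup \<mu> j"
  obtain F where "polynomial_map sc F" and F: "\<And>M. block j k M \<in> GL \<Longrightarrow> \<rho> (block j k M) x = F M"
    using act_block[OF jk] by blast
  then obtain S X where S: "finite S" and X: "\<And>M. F M = (\<Sum>e\<in>S. sc (monomial2 e M) (X e))"
    using polynomial_map_normal_form[OF vs] by metis
  \<comment> \<open>Scaling the columns by \<open>t\<close> and \<open>t ^ (c + 1)\<close> tests both degrees with one variable: a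
    monomial picks up \<open>t ^ w e\<close>, and \<open>w e = c\<close> forces the degree in the second column to be \<open>0\<close>.\<close>
  define w where "w = (\<lambda>(e\<^sub>1, e\<^sub>2, e\<^sub>3, e\<^sub>4). e\<^sub>1 + e\<^sub>3 + (c + 1) * (e\<^sub>2 + e\<^sub>4))"
  define Y where "Y d = (if (c - d, 0, d, 0) \<in> S then X (c - d, 0, d, 0) else 0)" for d
  have "\<rho> (block j k (\<alpha>, \<beta>, \<gamma>, \<delta>)) x = (\<Sum>d\<le>c. sc (\<alpha> ^ (c - d) * \<gamma> ^ d) (Y d))"
    if det: "\<alpha> * \<delta> - \<beta> * \<gamma> \<noteq> 0" for \<alpha> \<beta> \<gamma> \<delta>
  proof -
    let ?M = "(\<alpha>, \<beta>, \<gamma>, \<delta>)"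
    have GL: "block j k ?M \<in> GL" by (rule block_in_GL[OF jk det])
    interpret g: Vector_Spaces.linear sc sc "\<rho> (block j k ?M)" by (rule linear_act[OF GL])
    have "(\<Sum>e\<in>S. sc (t ^ w e) (sc (monomial2 e ?M) (X e)))
      = (\<Sum>e\<in>{()}. sc (t ^ c) (\<rho> (block j k ?M) x))" if t: "t \<noteq> 0" for t
    proof -
      define \<sigma> where "\<sigma> = ((\<lambda>_. 1)(j := t, k := t ^ (c + 1)))"
      have "finite {i. \<sigma> i \<noteq> 1}"
        by (rule finite_subset[of _ "{j, k}"]) (auto simp: \<sigma>_def)
      then have \<sigma>: "\<sigma> \<in> torus" using t by (auto simp: torus_def \<sigma>_def)
      let ?N = "(\<alpha> * t, \<beta> * t ^ (c + 1), \<gamma> * t, \<delta> * t ^ (c + 1))"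
      have comp: "block j k ?N = block j k ?M \<circ> diag \<sigma>"
        using jk by (simp add: \<sigma>_def diag_eq_block block_comp)
      have "(\<alpha> * t) * (\<delta> * t ^ (c + 1)) - (\<beta> * t ^ (c + 1)) * (\<gamma> * t)
        = (\<alpha> * \<delta> - \<beta> * \<gamma>) * t ^ (c + 2)" by (simp add: algebra_simps)
      then have GLN: "block j k ?N \<in> GL"
        using det t by (intro block_in_GL[OF jk]) simp
      have "weight_char \<mu> \<sigma> = t ^ c"
        using k by (simp add: \<sigma>_def weight_char_fun_upd2[OF jk] in_keys_iff c_def)
      then have "F ?N = sc (t ^ c) (\<rho> (block j k ?M) x)"
        unfolding F[OF GLN, symmetric] comp act_comp[OF GL diag_in_GL[OF \<sigma>]]
        using x \<sigma> by (simp add: has_weight_def g.scale)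
      moreover have "monomial2 e ?N = t ^ w e * monomial2 e ?M" for e
        by (cases e) (simp add: w_def power_add power_mult_distrib algebra_simps flip: power_mult)
      ultimately show ?thesis by (simp add: X)
    qed
    from coefficients_eq[OF infinite_field vs S _ this, where n = c]
    have "\<rho> (block j k ?M) x = (\<Sum>e | e \<in> S \<and> w e = c. sc (monomial2 e ?M) (X e))"
      by (simp add: UNIV_unit)
    also have "\<dots> = (\<Sum>d | d \<le> c \<and> (c - d, 0, d, 0) \<in> S. sc (\<alpha> ^ (c - d) * \<gamma> ^ d) (Y d))"
    proof (rule sum.reindex_bij_witness[where j = "\<lambda>(e\<^sub>1, e\<^sub>2, e\<^sub>3, e\<^sub>4). e\<^sub>3" and i = "\<lambda>d. (c - d, 0, d, 0)"])
      fix e assume e: "e \<in> {e. e \<in> S \<and> w e = c}"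
      obtain e\<^sub>1 e\<^sub>2 e\<^sub>3 e\<^sub>4 where e': "e = (e\<^sub>1, e\<^sub>2, e\<^sub>3, e\<^sub>4)" by (cases e)
      have sum: "e\<^sub>1 + e\<^sub>3 + (c + 1) * (e\<^sub>2 + e\<^sub>4) = c" using e by (simp add: e' w_def)
      have "e\<^sub>2 + e\<^sub>4 = 0"
      proof (rule ccontr)
        assume "e\<^sub>2 + e\<^sub>4 \<noteq> 0"
        then have "(c + 1) * 1 \<le> (c + 1) * (e\<^sub>2 + e\<^sub>4)" by (intro mult_le_mono2) linarith
        with sum show False by simp
      qed
      with sum have *: "e = (c - e\<^sub>3, 0, e\<^sub>3, 0)" "e\<^sub>3 \<le> c" by (auto simp: e')
      show "(c - (case e of (e\<^sub>1, e\<^sub>2, e\<^sub>3, e\<^sub>4) \<Rightarrow> e\<^sub>3), 0, (case e of (e\<^sub>1, e\<^sub>2, e\<^sub>3, e\<^sub>4) \<Rightarrow> e\<^sub>3), 0) = e"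
        using * by simp
      show "(case e of (e\<^sub>1, e\<^sub>2, e\<^sub>3, e\<^sub>4) \<Rightarrow> e\<^sub>3) \<in> {d. d \<le> c \<and> (c - d, 0, d, 0) \<in> S}"
        using * e by simp
      show "sc (\<alpha> ^ (c - (case e of (e\<^sub>1, e\<^sub>2, e\<^sub>3, e\<^sub>4) \<Rightarrow> e\<^sub>3)) * \<gamma> ^ (case e of (e\<^sub>1, e\<^sub>2, e\<^sub>3, e\<^sub>4) \<Rightarrow> e\<^sub>3))
          (Y (case e of (e\<^sub>1, e\<^sub>2, e\<^sub>3, e\<^sub>4) \<Rightarrow> e\<^sub>3)) = sc (monomial2 e ?M) (X e)"
        using * e by (simp add: Y_def)
    qed (auto simp: w_def)
    also have "\<dots> = (\<Sum>d\<le>c. sc (\<alpha> ^ (c - d) * \<gamma> ^ d) (Y d))"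
      by (rule sum.mono_neutral_left) (auto simp: Y_def)
    finally show ?thesis .
  qed
  then have "column_expansion sc \<rho> j k c x Y" by (simp add: column_expansion_def)
  then show thesis unfolding c_def by (rule that)
qed

context
  fixes j k c x X
  assumes jk: "j \<noteq> k" and X: "column_expansion sc \<rho> j k c x X"
begin

lemma act_unipotent: "\<rho> (block j k (1, 0, t, 1)) x = (\<Sum>d\<le>c. sc (t ^ d) (X d))"
  using X by (simp add: column_expansion_def)

lemma column_expansion_0: "X 0 = x"
proof -
  have "x = (\<Sum>d\<le>c. sc (0 ^ d) (X d))"
    using act_unipotent[of 0] by (simp add: block_id[OF jk] act_id)
  also have "\<dots> = (\<Sum>d\<le>c. if d = 0 then X 0 else 0)"
    by (rule sum.cong) auto
  finally show ?thesis by simp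
qed

lemma column_expansion_top: "X c = \<rho> (block j k (0, 1, 1, 0)) x"
proof -
  have "\<rho> (block j k (0, 1, 1, 0)) x = (\<Sum>d\<le>c. sc (0 ^ (c - d)) (X d))"
    using X by (simp add: column_expansion_def)
  also have "\<dots> = (\<Sum>d\<le>c. if d = c then X c else 0)"
    by (rule sum.cong) auto
  finally show ?thesis by simp
qed

lemma column_expansion_weight:
  assumes x: "has_weight \<mu> x" and k: "k \<notin> Poly_Mapping.keys \<mu>"
    and c: "c = Poly_Mapping.lookup \<mu> j" and d: "d \<le> c"
  shows "has_weight (move_weight j k d \<mu>) (X d)"
  unfolding has_weight_def
proof
  fix t :: "nat \<Rightarrow> 'k" assume t: "t \<in> torus"
  then have nz: "t j \<noteq> 0" "t k \<noteq> 0" by (auto simp: torus_def)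
  let ?t' = "t(j := 1, k := 1)"
  have "finite {i. ?t' i \<noteq> 1}"
    by (rule finite_subset[of _ "{i. t i \<noteq> 1}"]) (use t in \<open>auto simp: torus_def\<close>)
  then have t': "?t' \<in> torus" using t by (auto simp: torus_def)
  interpret g: Vector_Spaces.linear sc sc "\<rho> (diag t)" by (rule linear_act[OF diag_in_GL[OF t]])
  have "(\<Sum>d\<le>c. sc (s ^ d) (\<rho> (diag t) (X d)))
    = (\<Sum>d\<le>c. sc (s ^ d) (sc (weight_char (move_weight j k d \<mu>) t) (X d)))" for s
  proof -
    let ?N = "(t j, 0, t k * s, t k)"
    have GL: "block j k (1, 0, s, 1) \<in> GL" "block j k ?N \<in> GL"
      using nz by (auto intro!: block_in_GL[OF jk])
    interpret h: Vector_Spaces.linear sc sc "\<rho> (block j k ?N)" by (rule linear_act[OF GL(2)])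
    have "\<rho> (diag t) (\<rho> (block j k (1, 0, s, 1)) x) = \<rho> (diag t \<circ> block j k (1, 0, s, 1)) x"
      by (rule act_comp[symmetric, OF diag_in_GL[OF t] GL(1)])
    also have "\<dots> = \<rho> (block j k ?N \<circ> diag ?t') x"
      by (simp add: diag_block[OF jk])
    also have "\<dots> = sc (weight_char \<mu> ?t') (\<rho> (block j k ?N) x)"
      using x t' by (simp add: act_comp[OF GL(2) diag_in_GL[OF t']] has_weight_def h.scale)
    also have "\<rho> (block j k ?N) x = (\<Sum>d\<le>c. sc (t j ^ (c - d) * (t k * s) ^ d) (X d))"
      using X nz by (simp add: column_expansion_def)
    finally show ?thesis
      by (simp add: act_unipotent g.sum g.scale V.scale_sum_right weight_char_move_weight[OF jk k]
        c power_mult_distrib mult_ac fun_upd_def)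
  qed
  from coefficients_eq_atMost[OF infinite_field vs this d]
  show "\<rho> (diag t) (X d) = sc (weight_char (move_weight j k d \<mu>) t) (X d)" .
qed

lemma column_expansion_mem:
  assumes U: "subrep sc \<rho> U" and "x \<in> U" and "d \<le> c"
  shows "X d \<in> U"
proof -
  have sub: "module.subspace sc U" using U by (simp add: subrep_def)
  have "(\<Sum>d | d \<in> {..c} \<and> d = n. X d) - (\<Sum>d | d \<in> ({} :: nat set) \<and> d = n. X d) \<in> U" for n
  proof (rule coefficients_mem[OF infinite_field vs sub])
    fix t :: 'k
    have "block j k (1, 0, t, 1) \<in> GL" by (rule block_in_GL[OF jk]) simp
    then have "\<rho> (block j k (1, 0, t, 1)) x \<in> U"
      using U \<open>x \<in> U\<close> by (simp add: subrep_def)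
    then show "(\<Sum>d\<in>{..c}. sc (t ^ d) (X d)) - (\<Sum>d\<in>{}. sc (t ^ d) (X d)) \<in> U"
      by (simp add: act_unipotent)
  qed auto
  from this[of d] show ?thesis
    using \<open>d \<le> c\<close> by (simp add: conj_commute Collect_conv_if)
qed

text \<open>Apply \<open>e\<^sub>k \<mapsto> e\<^sub>k + s e\<^sub>j\<close> to both sides of \<open>act_unipotent\<close>. The composite is a block with
  first column \<open>(1 + s t, t)\<close>, so its action is known, and the coefficient of \<open>s\<^sup>d t\<^sup>d\<close> is
  \<open>(c choose d) x\<close> on one side; on the other side the coefficient of \<open>t\<^sup>d\<close> is the image of
  \<open>X d\<close>.\<close>

lemma column_expansion_nonzero:
  assumes d: "d \<le> c" and "X d = 0"
  shows "sc (of_nat (c choose d)) x = 0"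
proof -
  let ?S = "Sigma {..c} (\<lambda>e. {..c - e})"
  have "(\<Sum>z | z \<in> ?S \<and> fst z + snd z = d.
      sc (s ^ snd z) (sc (of_nat ((c - fst z) choose snd z)) (X (fst z)))) = 0" for s
  proof -
    have GL: "block j k (1, s, 0, 1) \<in> GL" by (rule block_in_GL[OF jk]) simp
    interpret h: Vector_Spaces.linear sc sc "\<rho> (block j k (1, s, 0, 1))" by (rule linear_act[OF GL])
    have "(\<Sum>z\<in>?S. sc (t ^ (fst z + snd z))
        (sc (s ^ snd z) (sc (of_nat ((c - fst z) choose snd z)) (X (fst z)))))
      = (\<Sum>d\<le>c. sc (t ^ d) (\<rho> (block j k (1, s, 0, 1)) (X d)))" for t
    proof -
      have GLt: "block j k (1, 0, t, 1) \<in> GL" by (rule block_in_GL[OF jk]) simp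
      have "(\<Sum>d\<le>c. sc (t ^ d) (\<rho> (block j k (1, s, 0, 1)) (X d)))
        = \<rho> (block j k (1, s, 0, 1) \<circ> block j k (1, 0, t, 1)) x"
        by (simp add: act_comp[OF GL GLt] act_unipotent h.sum h.scale)
      also have "\<dots> = (\<Sum>e\<le>c. sc ((1 + s * t) ^ (c - e) * t ^ e) (X e))"
        using X by (simp add: block_comp[OF jk] column_expansion_def)
      also have "\<dots> = (\<Sum>e\<le>c. \<Sum>i\<le>c - e. sc (t ^ (e + i))
        (sc (s ^ i) (sc (of_nat ((c - e) choose i)) (X e))))"
      proof (rule sum.cong)
        fix e
        have "(1 + s * t) ^ (c - e) = (s * t + 1) ^ (c - e)" by (simp add: add.commute)
        also have "\<dots> = (\<Sum>i\<le>c - e. of_nat ((c - e) choose i) * (s * t) ^ i)"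
          by (simp add: binomial_ring)
        finally show "sc ((1 + s * t) ^ (c - e) * t ^ e) (X e) = (\<Sum>i\<le>c - e. sc (t ^ (e + i))
          (sc (s ^ i) (sc (of_nat ((c - e) choose i)) (X e))))"
          by (simp add: sum_distrib_left sum_distrib_right V.scale_sum_left power_add power_mult_distrib mult_ac)
      qed simp
      finally show ?thesis by (simp add: sum.Sigma case_prod_beta)
    qed
    from coefficients_eq[OF infinite_field vs _ _ this, where n = d]
    have "(\<Sum>z | z \<in> ?S \<and> fst z + snd z = d.
      sc (s ^ snd z) (sc (of_nat ((c - fst z) choose snd z)) (X (fst z))))
      = (\<Sum>e | e \<in> {..c} \<and> e = d. \<rho> (block j k (1, s, 0, 1)) (X e))" by simp
    also have "\<dots> = 0"
      by (rule sum.neutral) (use \<open>X d = 0\<close> in \<open>auto simp: h.zero\<close>)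
    finally show ?thesis .
  qed
  then have "(\<Sum>z | z \<in> {z \<in> ?S. fst z + snd z = d} \<and> snd z = d.
      sc (of_nat ((c - fst z) choose snd z)) (X (fst z)))
    = (\<Sum>e | e \<in> ({} :: nat set) \<and> e = d. 0)"
    by (intro coefficients_eq[OF infinite_field vs]) (auto intro: finite_subset[of _ ?S])
  moreover have "{z. z \<in> {z \<in> ?S. fst z + snd z = d} \<and> snd z = d} = {(0, d)}"
    using d by auto
  ultimately show ?thesis by (simp add: column_expansion_0)
qed

end

lemma split_weight_vector:
  assumes U: "subrep sc \<rho> U" and x: "x \<in> U" "weight_vector sc \<rho> \<mu> x"
    and jk: "j \<noteq> k" and k: "k \<notin> Poly_Mapping.keys \<mu>"
    and d: "d \<le> Poly_Mapping.lookup \<mu> j"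
    and p: "\<not> CHAR('k) dvd (Poly_Mapping.lookup \<mu> j choose d)"
  obtains y where "y \<in> U" "weight_vector sc \<rho> (move_weight j k d \<mu>) y"
proof -
  have "has_weight \<mu> x" "x \<noteq> 0" using x by (auto simp: weight_vector_iff)
  obtain X where X: "column_expansion sc \<rho> j k (Poly_Mapping.lookup \<mu> j) x X"
    using column_expansion_exists[OF jk \<open>has_weight \<mu> x\<close> k] by blast
  have "X d \<noteq> 0"
    using column_expansion_nonzero[OF jk X d] p \<open>x \<noteq> 0\<close> by (auto simp: of_nat_eq_0_iff_char_dvd)
  moreover have "has_weight (move_weight j k d \<mu>) (X d)"
    by (rule column_expansion_weight[OF jk X \<open>has_weight \<mu> x\<close> k refl d])
  moreover have "X d \<in> U" by (rule column_expansion_mem[OF jk X U x(1) d])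
  ultimately show thesis using that by (simp add: weight_vector_iff)
qed

end

section \<open>Flat weights\<close>

text \<open>Write \<open>c = p\<^sup>i m\<close>, where \<open>i\<close> is the multiplicity of \<open>p\<close> in \<open>c\<close>: the multiplicity of \<open>p\<close> in
  \<open>p\<^sup>i m choose p\<^sup>i\<close> equals that in \<open>m\<close>.\<close>

lemma prime_power_choose_not_dvd:
  fixes c p :: nat
  assumes p: "prime p" and "c \<noteq> 0" and "\<And>i. c \<noteq> p ^ i"
  obtains i where "p ^ i < c" "\<not> p dvd (c choose p ^ i)"
proof -
  define i where "i = multiplicity p c"
  obtain m where m: "c = p ^ i * m" "\<not> p dvd m"
    using multiplicity_decompose'[of c p] \<open>c \<noteq> 0\<close> not_prime_unit[of p] p
    unfolding i_def by blast
  have "m \<noteq> 0" using m \<open>c \<noteq> 0\<close> by auto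
  then have "p ^ i \<le> c" using m(1) by simp
  with assms(3)[of i] have less: "p ^ i < c" by simp
  have "multiplicity p (c choose p ^ i) = 0"
    unfolding m(1) using const_p_fac[OF _ p, of m i] \<open>m \<noteq> 0\<close> m(2)
    by (simp add: not_dvd_imp_multiplicity_0)
  moreover have "c choose p ^ i \<noteq> 0" using less by simp
  ultimately have "\<not> p dvd (c choose p ^ i)"
    using p multiplicity_eq_zero_iff[of "c choose p ^ i" p] not_prime_unit[of p] by blast
  with less that show thesis by blast
qed

text \<open>No entry \<open>p\<^sup>i\<close> with \<open>i < r\<close> is lost on passing from \<open>\<mu>\<close> to \<open>\<nu>\<close>, and at least one is gained
  at \<open>j\<close>. The first exponent at which one is gained decides the lexicographic comparison; the entries
  of \<open>\<nu>\<close> outside the support of \<open>\<mu>\<close> can only help.\<close>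

lemma flat_less_by_splitting:
  assumes p: "p > 1" and r: "Poly_Mapping.lookup \<mu> j = p ^ r" and "flat p \<nu>"
    and j: "0 < Poly_Mapping.lookup \<nu> j" "Poly_Mapping.lookup \<nu> j < p ^ r"
    and other: "\<And>l. l \<in> Poly_Mapping.keys \<mu> \<Longrightarrow> l \<noteq> j \<Longrightarrow> Poly_Mapping.lookup \<nu> l = Poly_Mapping.lookup \<mu> l"
  shows "flat_less p \<nu> \<mu>"
proof -
  have fin: "finite {l. Poly_Mapping.lookup \<nu> l = p ^ i}" for i
    by (rule finite_subset[of _ "Poly_Mapping.keys \<nu>"]) (use p in \<open>auto simp: in_keys_iff\<close>)
  obtain i where i: "Poly_Mapping.lookup \<nu> j = p ^ i"
    using \<open>flat p \<nu>\<close> j(1) unfolding flat_def by (metis less_irrefl)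
  have "i < r" using j(2) p by (simp add: i)
  have sub: "{l. Poly_Mapping.lookup \<mu> l = p ^ i'} \<subseteq> {l. Poly_Mapping.lookup \<nu> l = p ^ i'}" if "i' < r" for i'
  proof
    fix l assume l: "l \<in> {l. Poly_Mapping.lookup \<mu> l = p ^ i'}"
    have "p ^ i' < p ^ r" using that p by simp
    then have "l \<noteq> j" using l r by auto
    moreover have "l \<in> Poly_Mapping.keys \<mu>" using l p by (auto simp: in_keys_iff)
    ultimately show "l \<in> {l. Poly_Mapping.lookup \<nu> l = p ^ i'}" using other l by simp
  qed
  have le: "p_mag p \<mu> i' \<le> p_mag p \<nu> i'" if "i' < r" for i'
    unfolding p_mag_def by (rule card_mono[OF fin sub[OF that]])
  have "j \<notin> {l. Poly_Mapping.lookup \<mu> l = p ^ i}" using i r j(2) by auto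
  then have "{l. Poly_Mapping.lookup \<mu> l = p ^ i} \<subset> {l. Poly_Mapping.lookup \<nu> l = p ^ i}"
    using sub[OF \<open>i < r\<close>] i by blast
  then have less: "p_mag p \<mu> i < p_mag p \<nu> i"
    unfolding p_mag_def by (rule psubset_card_mono[OF fin])
  define n where "n = (LEAST i. p_mag p \<mu> i < p_mag p \<nu> i)"
  have "p_mag p \<mu> n < p_mag p \<nu> n" unfolding n_def by (rule LeastI) (rule less)
  moreover have "p_mag p \<mu> i' = p_mag p \<nu> i'" if "i' < n" for i'
  proof -
    have "n \<le> i" unfolding n_def by (rule Least_le) (rule less)
    with that \<open>i < r\<close> le[of i'] not_less_Least[of i' "\<lambda>i. p_mag p \<mu> i < p_mag p \<nu> i"]
    show ?thesis by (simp add: n_def)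
  qed
  ultimately show ?thesis by (auto simp: flat_less_def intro: less_funI)
qed

context gl_polynomial_action_infinite
begin

text \<open>Splitting off a suitable power of \<open>p\<close> from an entry that is not a power of \<open>p\<close>, and
  repeating. The set \<open>K\<close> is kept free of new indices, so that there the flat entries are untouched
  and the others only shrink.\<close>

lemma flattening:
  assumes p: "p = CHAR('k)" "p > 0" and U: "subrep sc \<rho> U" and K: "finite K"
    and x: "x \<in> U" "weight_vector sc \<rho> \<mu> x"
  shows "\<exists>\<nu> y. y \<in> U \<and> weight_vector sc \<rho> \<nu> y \<and> flat p \<nu> \<and>
    (\<forall>l\<in>K. (Poly_Mapping.lookup \<mu> l = 0 \<or> (\<exists>i. Poly_Mapping.lookup \<mu> l = p ^ i) \<longrightarrow>
          Poly_Mapping.lookup \<nu> l = Poly_Mapping.lookup \<mu> l) \<and>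
       (0 < Poly_Mapping.lookup \<mu> l \<longrightarrow>
          0 < Poly_Mapping.lookup \<nu> l \<and> Poly_Mapping.lookup \<nu> l \<le> Poly_Mapping.lookup \<mu> l))"
proof -
  have prime: "prime p" using p by (simp add: prime_CHAR_semidom)
  \<comment> \<open>The part split off is a power of \<open>p\<close>, so the total of the remaining bad entries drops.\<close>
  define bad where
    "bad \<mu> = {l \<in> Poly_Mapping.keys \<mu>. \<not> (\<exists>i. Poly_Mapping.lookup \<mu> l = p ^ i)}" for \<mu> :: weight
  define size where "size \<mu> = (\<Sum>l\<in>bad \<mu>. Poly_Mapping.lookup \<mu> l)" for \<mu>
  show ?thesis using x
  proof (induction "size \<mu>" arbitrary: \<mu> x rule: less_induct)
    case less
    show ?case
    proof (cases "flat p \<mu>")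
      case True
      with less.prems show ?thesis by blast
    next
      case False
      then obtain j where j: "Poly_Mapping.lookup \<mu> j \<noteq> 0" "\<And>i. Poly_Mapping.lookup \<mu> j \<noteq> p ^ i"
        by (auto simp: flat_def)
      obtain i where i: "p ^ i < Poly_Mapping.lookup \<mu> j"
        "\<not> p dvd (Poly_Mapping.lookup \<mu> j choose p ^ i)"
        by (rule prime_power_choose_not_dvd[OF prime j])
      obtain k where k: "k \<notin> K \<union> Poly_Mapping.keys \<mu>"
        using ex_new_if_finite[of "K \<union> Poly_Mapping.keys \<mu>"] K by auto
      have jk: "j \<noteq> k" using j(1) k by (auto simp: in_keys_iff)
      let ?\<mu>' = "move_weight j k (p ^ i) \<mu>"
      obtain x' where x': "x' \<in> U" "weight_vector sc \<rho> ?\<mu>' x'"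
        using split_weight_vector[OF U less.prems jk, of "p ^ i"] k i p(1) by auto
      have fin: "finite (bad \<mu>)" by (simp add: bad_def)
      have "bad ?\<mu>' \<subseteq> bad \<mu>"
        using j by (auto simp: bad_def in_keys_iff lookup_move_weight split: if_splits)
      then have "size ?\<mu>' \<le> (\<Sum>l\<in>bad \<mu>. Poly_Mapping.lookup ?\<mu>' l)"
        unfolding size_def by (intro sum_mono2 fin) auto
      also have "\<dots> < size \<mu>"
        unfolding size_def
      proof (rule sum_strict_mono_ex1[OF fin])
        show "\<forall>l\<in>bad \<mu>. Poly_Mapping.lookup ?\<mu>' l \<le> Poly_Mapping.lookup \<mu> l"
          using k by (auto simp: bad_def lookup_move_weight)
        show "\<exists>l\<in>bad \<mu>. Poly_Mapping.lookup ?\<mu>' l < Poly_Mapping.lookup \<mu> l"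
          using j prime by (intro bexI[of _ j])
            (auto simp: bad_def lookup_move_weight in_keys_iff prime_gt_0_nat)
      qed
      finally have "size ?\<mu>' < size \<mu>" .
      from less.hyps[OF this x'] obtain \<nu> y where y: "y \<in> U" "weight_vector sc \<rho> \<nu> y" "flat p \<nu>"
        and \<nu>: "\<forall>l\<in>K. (Poly_Mapping.lookup ?\<mu>' l = 0 \<or> (\<exists>i. Poly_Mapping.lookup ?\<mu>' l = p ^ i) \<longrightarrow>
          Poly_Mapping.lookup \<nu> l = Poly_Mapping.lookup ?\<mu>' l) \<and>
       (0 < Poly_Mapping.lookup ?\<mu>' l \<longrightarrow>
          0 < Poly_Mapping.lookup \<nu> l \<and> Poly_Mapping.lookup \<nu> l \<le> Poly_Mapping.lookup ?\<mu>' l)"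
        by blast
      show ?thesis
      proof (intro exI[of _ \<nu>] exI[of _ y] conjI y ballI)
        fix l assume l: "l \<in> K"
        then have "l \<noteq> k" using k by auto
        show "Poly_Mapping.lookup \<mu> l = 0 \<or> (\<exists>i. Poly_Mapping.lookup \<mu> l = p ^ i) \<longrightarrow>
          Poly_Mapping.lookup \<nu> l = Poly_Mapping.lookup \<mu> l"
          using bspec[OF \<nu> l] \<open>l \<noteq> k\<close> j by (auto simp: lookup_move_weight split: if_splits)
        show "0 < Poly_Mapping.lookup \<mu> l \<longrightarrow>
          0 < Poly_Mapping.lookup \<nu> l \<and> Poly_Mapping.lookup \<nu> l \<le> Poly_Mapping.lookup \<mu> l"
          using bspec[OF \<nu> l] \<open>l \<noteq> k\<close> i(1) by (auto simp: lookup_move_weight split: if_splits)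
      qed
    qed
  qed
qed

end

section \<open>Splitting a tensor\<close>

lemma tensor_functional:
  assumes tp: "tensor_product sV sW (sT :: 'k::field \<Rightarrow> 't::ab_group_add \<Rightarrow> 't) tens"
    and \<phi>: "Vector_Spaces.linear sV (*) \<phi>" and \<psi>: "Vector_Spaces.linear sW (*) \<psi>"
  obtains h where "Vector_Spaces.linear sT (*) h" "\<And>v w. h (tens v w) = \<phi> v * \<psi> w"
proof -
  have "bilinear_map sV sW (*) (\<lambda>v w. \<phi> v * \<psi> w)"
    using \<phi> \<psi> by (auto simp: bilinear_map_def Vector_Spaces.linear_iff algebra_simps)
  from tensor_product_universal[OF tp vector_space_mult this] that show thesis by blast
qed

text \<open>The functional dual to \<open>v i \<otimes> w i\<close> reads off the character by which the torus acts on this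
  term; varying one entry of the torus element isolates one entry of the weights.\<close>

lemma tensor_weight:
  fixes sT :: "'k::field \<Rightarrow> 't::ab_group_add \<Rightarrow> 't"
  assumes inf: "infinite (UNIV :: 'k set)"
    and T: "tensor_product_rep sV \<rho>V sW \<rho>W sT \<rho>T tens"
    and N: "finite N" "i \<in> N" and u: "weight_vector sT \<rho>T \<mu> (\<Sum>i\<in>N. tens (v i) (w i))"
    and v: "inj_on v N" "\<not> module.dependent sV (v ` N)"
    and w: "inj_on w N" "\<not> module.dependent sW (w ` N)"
    and a: "\<And>i. i \<in> N \<Longrightarrow> weight_vector sV \<rho>V (a i) (v i)"
    and b: "\<And>i. i \<in> N \<Longrightarrow> weight_vector sW \<rho>W (b i) (w i)"
  shows "Poly_Mapping.lookup (a i) l + Poly_Mapping.lookup (b i) l = Poly_Mapping.lookup \<mu> l"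
proof (rule power_eq_imp_exponent_eq[OF inf])
  fix t :: 'k assume "t \<noteq> 0"
  have tp: "tensor_product sV sW sT tens"
    and vs: "vector_space sV" "vector_space sW"
    using T by (auto simp: tensor_product_rep_def tensor_product_def)
  let ?u = "\<Sum>i\<in>N. tens (v i) (w i)"
  obtain \<phi> where \<phi>: "Vector_Spaces.linear sV (*) \<phi>" "\<And>l. l \<in> N \<Longrightarrow> \<phi> (v l) = (if l = i then 1 else 0)"
    using dual_functional[OF vs(1) v(2,1) N(2)] by blast
  obtain \<psi> where \<psi>: "Vector_Spaces.linear sW (*) \<psi>" "\<And>l. l \<in> N \<Longrightarrow> \<psi> (w l) = (if l = i then 1 else 0)"
    using dual_functional[OF vs(2) w(2,1) N(2)] by blast
  obtain h where h: "Vector_Spaces.linear sT (*) h" "\<And>v w. h (tens v w) = \<phi> v * \<psi> w"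
    using tensor_functional[OF tp \<phi>(1) \<psi>(1)] by blast
  interpret \<phi>: Vector_Spaces.linear sV "(*)" \<phi> by fact
  interpret \<psi>: Vector_Spaces.linear sW "(*)" \<psi> by fact
  interpret h: Vector_Spaces.linear sT "(*)" h by fact
  define \<sigma> where "\<sigma> = (\<lambda>_. 1 :: 'k)(l := t)"
  have char: "weight_char \<nu> \<sigma> = t ^ Poly_Mapping.lookup \<nu> l" for \<nu>
    unfolding \<sigma>_def by (rule weight_char_fun_upd)
  have "finite {i. \<sigma> i \<noteq> 1}" by (rule finite_subset[of _ "{l}"]) (auto simp: \<sigma>_def)
  then have \<sigma>: "\<sigma> \<in> torus" using \<open>t \<noteq> 0\<close> by (auto simp: torus_def \<sigma>_def)
  interpret g: Vector_Spaces.linear sT sT "\<rho>T (diag \<sigma>)"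
    using T diag_in_GL[OF \<sigma>] by (simp add: tensor_product_rep_def)
  have actT: "\<rho>T (diag \<sigma>) (tens x y) = tens (\<rho>V (diag \<sigma>) x) (\<rho>W (diag \<sigma>) y)" for x y
    using T diag_in_GL[OF \<sigma>] unfolding tensor_product_rep_def by blast
  have act: "\<rho>V (diag \<sigma>) (v i) = sV (t ^ Poly_Mapping.lookup (a i) l) (v i)"
    "\<rho>W (diag \<sigma>) (w i) = sW (t ^ Poly_Mapping.lookup (b i) l) (w i)" if "i \<in> N" for i
    using a[OF that] b[OF that] \<sigma>
    unfolding weight_vector_def weight_char_def[symmetric] by (simp_all add: char)
  have "h (\<rho>T (diag \<sigma>) ?u) = (\<Sum>i'\<in>N. \<phi> (\<rho>V (diag \<sigma>) (v i')) * \<psi> (\<rho>W (diag \<sigma>) (w i')))"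
    by (simp only: g.sum h.sum h(2) actT)
  also have "\<dots>
    = (\<Sum>i'\<in>N. t ^ (Poly_Mapping.lookup (a i') l + Poly_Mapping.lookup (b i') l) * (\<phi> (v i') * \<psi> (w i')))"
    by (rule sum.cong) (simp_all only: act \<phi>.scale \<psi>.scale power_add mult_ac)
  also have "\<dots> = (\<Sum>i'\<in>N. if i' = i then t ^ (Poly_Mapping.lookup (a i) l + Poly_Mapping.lookup (b i) l) else 0)"
    by (rule sum.cong) (auto simp: \<phi>(2) \<psi>(2))
  also have "\<dots> = t ^ (Poly_Mapping.lookup (a i) l + Poly_Mapping.lookup (b i) l)" using N by simp
  finally have 1: "h (\<rho>T (diag \<sigma>) ?u) = \<dots>" .
  have "h (\<rho>T (diag \<sigma>) ?u) = t ^ Poly_Mapping.lookup \<mu> l * h ?u"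
    using u \<sigma> unfolding weight_vector_def weight_char_def[symmetric]
    by (simp add: char h.scale)
  also have "h ?u = (\<Sum>i'\<in>N. if i' = i then 1 else 0)"
    unfolding h.sum by (rule sum.cong) (auto simp: h(2) \<phi>(2) \<psi>(2))
  also have "\<dots> = 1" using N by simp
  finally show "t ^ (Poly_Mapping.lookup (a i) l + Poly_Mapping.lookup (b i) l) = t ^ Poly_Mapping.lookup \<mu> l"
    using 1 by simp
qed

text \<open>Expanding both factors, \<open>X A\<close> is the sum of the tensors \<open>Y l d \<otimes> Z l e\<close> with \<open>d + e = A\<close>.
  The weights at \<open>j\<close> and \<open>k\<close> of the left factor are \<open>a l j - d\<close> and \<open>d\<close>; asking for \<open>0\<close> and \<open>A\<close>
  leaves the terms with \<open>d = A = a l j\<close> and \<open>e = 0\<close>, which are the top coefficient of \<open>v l\<close>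
  (its image under the transposition) and \<open>w l\<close>. These remain independent. An operator on the left
  factor alone does not come from the group action on the tensor product, so everything is tested with
  functionals \<open>\<phi> \<otimes> \<psi>\<close>, where the operator can be composed with \<open>\<phi>\<close>.\<close>

lemma column_expansion_tensor_nonzero:
  fixes sT :: "'k::field \<Rightarrow> 't::ab_group_add \<Rightarrow> 't" and N :: "'i set"
  assumes V: "gl_polynomial_action_infinite sV \<rho>V" and W: "gl_polynomial_action_infinite sW \<rho>W"
    and T: "tensor_product_rep sV \<rho>V sW \<rho>W sT \<rho>T tens"
    and N: "finite N" "i \<in> N"
    and v: "inj_on v N" "\<not> module.dependent sV (v ` N)"
    and w: "inj_on w N" "\<not> module.dependent sW (w ` N)"
    and a: "\<And>i. i \<in> N \<Longrightarrow> weight_vector sV \<rho>V (a i) (v i)"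
    and b: "\<And>i. i \<in> N \<Longrightarrow> weight_vector sW \<rho>W (b i) (w i)"
    and jk: "j \<noteq> k"
    and k: "\<And>i. i \<in> N \<Longrightarrow> k \<notin> Poly_Mapping.keys (a i) \<union> Poly_Mapping.keys (b i)"
    and X: "column_expansion sT \<rho>T j k c (\<Sum>i\<in>N. tens (v i) (w i)) X"
    and c: "Poly_Mapping.lookup (a i) j \<le> c"
  shows "X (Poly_Mapping.lookup (a i) j) \<noteq> 0"
proof
  define A where "A = Poly_Mapping.lookup (a i) j"
  assume "X (Poly_Mapping.lookup (a i) j) = 0"
  then have XA: "X A = 0" by (simp add: A_def)
  interpret V: gl_polynomial_action_infinite sV \<rho>V by fact
  interpret W: gl_polynomial_action_infinite sW \<rho>W by fact
  let ?u = "\<Sum>i\<in>N. tens (v i) (w i)"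
  have tp: "tensor_product sV sW sT tens"
    and act: "\<And>g v w. g \<in> GL \<Longrightarrow> \<rho>T g (tens v w) = tens (\<rho>V g v) (\<rho>W g w)"
    and lin: "\<And>g. g \<in> GL \<Longrightarrow> Vector_Spaces.linear sT sT (\<rho>T g)"
    using T by (auto simp: tensor_product_rep_def)
  have "\<exists>Y. column_expansion sV \<rho>V j k (Poly_Mapping.lookup (a i) j) (v i) Y" if "i \<in> N" for i
    using V.column_expansion_exists[OF jk] a[OF that] k[OF that] by (metis V.weight_vector_iff Un_iff)
  then obtain Y where Y: "\<And>i. i \<in> N \<Longrightarrow> column_expansion sV \<rho>V j k (Poly_Mapping.lookup (a i) j) (v i) (Y i)"
    by metis
  have "\<exists>Z. column_expansion sW \<rho>W j k (Poly_Mapping.lookup (b i) j) (w i) Z" if "i \<in> N" for i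
    using W.column_expansion_exists[OF jk] b[OF that] k[OF that] by (metis W.weight_vector_iff Un_iff)
  then obtain Z where Z: "\<And>i. i \<in> N \<Longrightarrow> column_expansion sW \<rho>W j k (Poly_Mapping.lookup (b i) j) (w i) (Z i)"
    by metis
  let ?S = "Sigma N (\<lambda>i. {..Poly_Mapping.lookup (a i) j} \<times> {..Poly_Mapping.lookup (b i) j})"
  have S: "finite ?S" using N by auto
  have coeff: "(\<Sum>z | z \<in> ?S \<and> fst (snd z) + snd (snd z) = A.
      \<phi> (Y (fst z) (fst (snd z))) * \<psi> (Z (fst z) (snd (snd z)))) = 0"
    if \<phi>: "Vector_Spaces.linear sV (*) \<phi>" and \<psi>: "Vector_Spaces.linear sW (*) \<psi>" for \<phi> \<psi>
  proof -
    obtain h where h: "Vector_Spaces.linear sT (*) h" "\<And>v w. h (tens v w) = \<phi> v * \<psi> w"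
      using tensor_functional[OF tp \<phi> \<psi>] by blast
    interpret \<phi>: Vector_Spaces.linear sV "(*)" \<phi> by fact
    interpret \<psi>: Vector_Spaces.linear sW "(*)" \<psi> by fact
    interpret h: Vector_Spaces.linear sT "(*)" h by fact
    have "(\<Sum>z\<in>?S. t ^ (fst (snd z) + snd (snd z)) * (\<phi> (Y (fst z) (fst (snd z))) * \<psi> (Z (fst z) (snd (snd z)))))
      = (\<Sum>d\<le>c. t ^ d * h (X d))" for t
    proof -
      let ?g = "block j k (1, 0, t, 1)"
      have GL: "?g \<in> GL" by (rule block_in_GL[OF jk]) simp
      interpret g: Vector_Spaces.linear sT sT "\<rho>T ?g" by (rule lin[OF GL])
      have "(\<Sum>d\<le>c. t ^ d * h (X d)) = h (\<rho>T ?g ?u)"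
        using X by (simp add: column_expansion_def h.sum h.scale)
      also have "\<dots> = (\<Sum>i\<in>N. \<phi> (\<rho>V ?g (v i)) * \<psi> (\<rho>W ?g (w i)))"
        by (simp add: g.sum h.sum act[OF GL] h(2))
      also have "\<dots> = (\<Sum>i\<in>N. \<Sum>d\<le>Poly_Mapping.lookup (a i) j. \<Sum>e\<le>Poly_Mapping.lookup (b i) j.
          t ^ (d + e) * (\<phi> (Y i d) * \<psi> (Z i e)))"
        by (rule sum.cong) (simp_all only: V.act_unipotent[OF jk Y] W.act_unipotent[OF jk Z]
          \<phi>.sum \<phi>.scale \<psi>.sum \<psi>.scale sum_product power_add mult_ac)
      also have "\<dots> = (\<Sum>z\<in>?S. t ^ (fst (snd z) + snd (snd z)) * (\<phi> (Y (fst z) (fst (snd z))) * \<psi> (Z (fst z) (snd (snd z)))))"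
        using N(1) by (simp add: sum.Sigma sum.cartesian_product case_prod_beta)
      finally show ?thesis ..
    qed
    then have "(\<Sum>z | z \<in> ?S \<and> fst (snd z) + snd (snd z) = A. \<phi> (Y (fst z) (fst (snd z))) * \<psi> (Z (fst z) (snd (snd z))))
      = (\<Sum>d | d \<in> {..c} \<and> d = A. h (X d))"
      by (intro coefficients_eq[OF V.infinite_field vector_space_mult S]) auto
    also have "\<dots> = 0" by (rule sum.neutral) (use XA in \<open>auto simp: h.zero\<close>)
    finally show ?thesis .
  qed
  let ?s = "block j k (0, 1, 1, 0) :: 'k gl"
  have GLs: "?s \<in> GL" by (rule block_in_GL[OF jk]) simp
  have ss: "?s \<circ> ?s = id" using block_id[OF jk] by (simp add: block_comp[OF jk])
  obtain \<phi> where \<phi>: "Vector_Spaces.linear sV (*) \<phi>" "\<And>l. l \<in> N \<Longrightarrow> \<phi> (v l) = (if l = i then 1 else 0)"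
    using dual_functional[OF V.vs v(2,1) N(2)] by blast
  obtain \<psi> where \<psi>: "Vector_Spaces.linear sW (*) \<psi>" "\<And>l. l \<in> N \<Longrightarrow> \<psi> (w l) = (if l = i then 1 else 0)"
    using dual_functional[OF W.vs w(2,1) N(2)] by blast
  interpret \<phi>: Vector_Spaces.linear sV "(*)" \<phi> by fact
  interpret s: Vector_Spaces.linear sV sV "\<rho>V ?s" by (rule V.linear_act[OF GLs])
  \<comment> \<open>Torus element with entries \<open>t ^ (A + 1)\<close> at \<open>j\<close> and \<open>t\<close> at \<open>k\<close>, acting on the left factor:
    the exponent \<open>e\<close> equals \<open>A\<close> only for weight \<open>0\<close> at \<open>j\<close> and weight \<open>A\<close> at \<open>k\<close>.\<close>
  define e where "e = (\<lambda>(i, d, d' :: nat). (A + 1) * (Poly_Mapping.lookup (a i) j - d) + d)"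
  have "(\<Sum>z | z \<in> ?S \<and> fst (snd z) + snd (snd z) = A.
      t ^ e z * (\<phi> (\<rho>V ?s (Y (fst z) (fst (snd z)))) * \<psi> (Z (fst z) (snd (snd z)))))
    = (\<Sum>z\<in>{}. t ^ (0 :: nat) * 0)" if "t \<noteq> 0" for t
  proof -
    define \<sigma> where "\<sigma> = (\<lambda>_. 1 :: 'k)(j := t ^ (A + 1), k := t)"
    have char: "weight_char \<nu> \<sigma> = (t ^ (A + 1)) ^ Poly_Mapping.lookup \<nu> j * t ^ Poly_Mapping.lookup \<nu> k" for \<nu>
      unfolding \<sigma>_def by (rule weight_char_fun_upd2[OF jk])
    have "finite {i. \<sigma> i \<noteq> 1}" by (rule finite_subset[of _ "{j, k}"]) (auto simp: \<sigma>_def)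
    then have \<sigma>: "\<sigma> \<in> torus" using \<open>t \<noteq> 0\<close> by (auto simp: torus_def \<sigma>_def)
    interpret g: Vector_Spaces.linear sV sV "\<rho>V (diag \<sigma>)" by (rule V.linear_act[OF diag_in_GL[OF \<sigma>]])
    have "Vector_Spaces.linear sV (*) (\<lambda>x. \<phi> (\<rho>V ?s (\<rho>V (diag \<sigma>) x)))"
      using V.vs vector_space_mult
      by (simp add: Vector_Spaces.linear_iff \<phi>.add \<phi>.scale s.add s.scale g.add g.scale)
    from coeff[OF this \<psi>(1)]
    have "(\<Sum>z | z \<in> ?S \<and> fst (snd z) + snd (snd z) = A.
      \<phi> (\<rho>V ?s (\<rho>V (diag \<sigma>) (Y (fst z) (fst (snd z))))) * \<psi> (Z (fst z) (snd (snd z)))) = 0" .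
    moreover have "\<phi> (\<rho>V ?s (\<rho>V (diag \<sigma>) (Y (fst z) (fst (snd z))))) * \<psi> (Z (fst z) (snd (snd z)))
      = t ^ e z * (\<phi> (\<rho>V ?s (Y (fst z) (fst (snd z)))) * \<psi> (Z (fst z) (snd (snd z))))"
      if "z \<in> ?S" for z
    proof -
      obtain i' d d' where z: "z = (i', d, d')" by (cases z)
      then have i': "i' \<in> N" "d \<le> Poly_Mapping.lookup (a i') j" using that by auto
      have "V.has_weight (move_weight j k d (a i')) (Y i' d)"
        using V.column_expansion_weight[OF jk Y[OF i'(1)] _ _ refl i'(2)] a[OF i'(1)] k[OF i'(1)]
        by (simp add: V.weight_vector_iff)
      moreover have "weight_char (move_weight j k d (a i')) \<sigma> = t ^ e z"
        using jk by (simp add: char lookup_move_weight e_def z power_add power_mult power_mult_distrib)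
      ultimately have "\<rho>V (diag \<sigma>) (Y i' d) = sV (t ^ e z) (Y i' d)"
        using \<sigma> by (simp only: V.has_weight_def)
      then show ?thesis by (simp add: z s.scale \<phi>.scale)
    qed
    ultimately have "(\<Sum>z | z \<in> ?S \<and> fst (snd z) + snd (snd z) = A.
      t ^ e z * (\<phi> (\<rho>V ?s (Y (fst z) (fst (snd z)))) * \<psi> (Z (fst z) (snd (snd z))))) = 0"
      by (metis (mono_tags, lifting) mem_Collect_eq sum.cong)
    then show ?thesis by simp
  qed
  then have "(\<Sum>z | z \<in> {z \<in> ?S. fst (snd z) + snd (snd z) = A} \<and> e z = A.
      \<phi> (\<rho>V ?s (Y (fst z) (fst (snd z)))) * \<psi> (Z (fst z) (snd (snd z))))
    = (\<Sum>z | z \<in> {} \<and> 0 = A. 0)"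
    by (intro coefficients_eq[OF V.infinite_field vector_space_mult]) (auto intro: finite_subset[OF _ S])
  moreover have "{z. z \<in> {z \<in> ?S. fst (snd z) + snd (snd z) = A} \<and> e z = A}
    = (\<lambda>i. (i, A, 0)) ` {i \<in> N. Poly_Mapping.lookup (a i) j = A}" (is "?L = ?R")
  proof
    show "?R \<subseteq> ?L" by (auto simp: e_def)
    show "?L \<subseteq> ?R"
    proof
      fix z assume z: "z \<in> ?L"
      obtain i' d d' where z': "z = (i', d, d')" by (cases z)
      from z have *: "i' \<in> N" "d \<le> Poly_Mapping.lookup (a i') j" "d + d' = A"
        and eA: "(A + 1) * (Poly_Mapping.lookup (a i') j - d) + d = A" by (auto simp: z' e_def)
      have "Poly_Mapping.lookup (a i') j - d = 0"
      proof (rule ccontr)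
        assume "Poly_Mapping.lookup (a i') j - d \<noteq> 0"
        then have "(A + 1) * 1 \<le> (A + 1) * (Poly_Mapping.lookup (a i') j - d)" by (intro mult_le_mono2) simp
        with eA show False by simp
      qed
      with eA * show "z \<in> ?R" by (auto simp: z')
    qed
  qed
  moreover have "sum f ((\<lambda>i. (i, A, 0 :: nat)) ` M) = (\<Sum>i\<in>M. f (i, A, 0))"
    for f :: "'i \<times> nat \<times> nat \<Rightarrow> 'k" and M
    by (subst sum.reindex) (auto intro: inj_onI)
  ultimately have "(\<Sum>i' | i' \<in> N \<and> Poly_Mapping.lookup (a i') j = A.
      \<phi> (\<rho>V ?s (Y i' A)) * \<psi> (Z i' 0)) = 0"
    by simp
  moreover have "\<phi> (\<rho>V ?s (Y i' A)) * \<psi> (Z i' 0) = (if i' = i then 1 else 0)"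
    if "i' \<in> N" "Poly_Mapping.lookup (a i') j = A" for i'
  proof -
    have "\<rho>V ?s (Y i' A) = v i'"
      using V.column_expansion_top[OF jk Y[OF that(1)]] that(2)
      by (simp add: ss V.act_id flip: V.act_comp[OF GLs GLs])
    moreover have "Z i' 0 = w i'" by (rule W.column_expansion_0[OF jk Z[OF that(1)]])
    ultimately show ?thesis using that \<phi>(2) \<psi>(2) by simp
  qed
  ultimately have "(\<Sum>i' | i' \<in> N \<and> Poly_Mapping.lookup (a i') j = A. if i' = i then 1 else 0) = (0 :: 'k)"
    by simp
  then show False using N by (simp add: A_def)
qed

theorem proposition4p8:
  fixes sV :: "'k::field \<Rightarrow> 'v::ab_group_add \<Rightarrow> 'v" and \<rho>V :: "'k gl \<Rightarrow> 'v \<Rightarrow> 'v"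
    and sW :: "'k \<Rightarrow> 'w::ab_group_add \<Rightarrow> 'w" and \<rho>W :: "'k gl \<Rightarrow> 'w \<Rightarrow> 'w"
    and sT :: "'k \<Rightarrow> 't::ab_group_add \<Rightarrow> 't" and \<rho>T :: "'k gl \<Rightarrow> 't \<Rightarrow> 't"
    and tens :: "'v \<Rightarrow> 'w \<Rightarrow> 't"
    and I :: "'i set" and J :: "'j set"
    and p n m s :: nat
    and U :: "'t set" and u :: 't
    and v :: "nat \<Rightarrow> 'v" and w :: "nat \<Rightarrow> 'w" and a b :: "nat \<Rightarrow> weight"
  assumes "infinite (UNIV :: 'k set)" and "p = CHAR('k)" and "p > 0"
    and "homogeneous_polynomial_rep I n sV \<rho>V" and "n > 0"
    and "homogeneous_polynomial_rep J m sW \<rho>W" and "m > 0"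
    and "tensor_product_rep sV \<rho>V sW \<rho>W sT \<rho>T tens"
    and "subrep sT \<rho>T U" and "U \<noteq> {0}"
    and "minimally_flat p sT \<rho>T U u"
    and "u = (\<Sum>i=1..s. tens (v i) (w i))"
    and "inj_on v {1..s}" and "\<not> module.dependent sV (v ` {1..s})"
    and "inj_on w {1..s}" and "\<not> module.dependent sW (w ` {1..s})"
    and "\<forall>i\<in>{1..s}. weight_vector sV \<rho>V (a i) (v i)"
    and "\<forall>i\<in>{1..s}. weight_vector sW \<rho>W (b i) (w i)"
  shows "\<forall>i\<in>{1..s}. Poly_Mapping.keys (a i) \<inter> Poly_Mapping.keys (b i) = {}"
proof (intro ballI equals0I)
  note inf = assms(1) and p = assms(2,3) and T = assms(8) and U = assms(9) and u = assms(12)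
  note indep = assms(13-16)
  have a: "weight_vector sV \<rho>V (a i) (v i)" and b: "weight_vector sW \<rho>W (b i) (w i)"
    if "i \<in> {1..s}" for i using assms(17,18) that by auto
  have actV: "gl_polynomial_action sV \<rho>V" and actW: "gl_polynomial_action sW \<rho>W"
    using assms(4,6) by (auto simp: homogeneous_polynomial_rep_def
      intro: polynomial_rep_imp_gl_polynomial_action)
  note actT = tensor_product_gl_polynomial_action[OF actV actW T]
  note V = gl_polynomial_action_infinite.intro[OF actV gl_polynomial_action_infinite_axioms.intro[OF inf]]
  note W = gl_polynomial_action_infinite.intro[OF actW gl_polynomial_action_infinite_axioms.intro[OF inf]]
  interpret T: gl_polynomial_action_infinite sT \<rho>T
    by (rule gl_polynomial_action_infinite.intro[OF actT gl_polynomial_action_infinite_axioms.intro[OF inf]])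
  have "prime p" using p by (simp add: prime_CHAR_semidom)
  then have "p > 1" by (rule prime_gt_1_nat)
  fix i j assume i: "i \<in> {1..s}" and j: "j \<in> Poly_Mapping.keys (a i) \<inter> Poly_Mapping.keys (b i)"
  obtain \<mu> where \<mu>: "weight_vector sT \<rho>T \<mu> u" "flat p \<mu>" and "u \<in> U"
    and minimal: "\<And>\<nu> x. x \<in> U \<Longrightarrow> weight_vector sT \<rho>T \<nu> x \<Longrightarrow> flat p \<nu> \<Longrightarrow> \<not> flat_less p \<nu> \<mu>"
    using assms(11) unfolding minimally_flat_def by blast
  have weights: "Poly_Mapping.lookup (a i) l + Poly_Mapping.lookup (b i) l = Poly_Mapping.lookup \<mu> l"
    if "i \<in> {1..s}" for i l
    by (rule tensor_weight[OF inf T _ that \<mu>(1)[unfolded u] indep a b]) auto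
  define A where "A = Poly_Mapping.lookup (a i) j"
  have A: "0 < A" "A < Poly_Mapping.lookup \<mu> j"
    using j weights[OF i, of j] by (auto simp: A_def in_keys_iff)
  obtain r where r: "Poly_Mapping.lookup \<mu> j = p ^ r"
    using \<mu>(2) A unfolding flat_def by (metis not_less_zero)
  obtain k where k: "k \<notin> Poly_Mapping.keys \<mu>"
    using ex_new_if_finite[of "Poly_Mapping.keys \<mu>"] by auto
  have jk: "j \<noteq> k" using A k by (auto simp: in_keys_iff)
  have k': "k \<notin> Poly_Mapping.keys (a i) \<union> Poly_Mapping.keys (b i)" if "i \<in> {1..s}" for i
    using weights[OF that, of k] k by (auto simp: in_keys_iff)
  have hw: "T.has_weight \<mu> u" using \<mu>(1) by (simp add: T.weight_vector_iff)
  obtain X where X: "column_expansion sT \<rho>T j k (Poly_Mapping.lookup \<mu> j) u X"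
    using T.column_expansion_exists[OF jk hw k] by blast
  have "X A \<noteq> 0"
    unfolding A_def
    by (rule column_expansion_tensor_nonzero[OF V W T _ i indep a b jk k' X[unfolded u]])
      (use A in \<open>auto simp: A_def\<close>)
  moreover have "T.has_weight (move_weight j k A \<mu>) (X A)"
    using T.column_expansion_weight[OF jk X hw k refl] A by simp
  ultimately have wX: "weight_vector sT \<rho>T (move_weight j k A \<mu>) (X A)"
    by (simp add: T.weight_vector_iff)
  have "X A \<in> U" using T.column_expansion_mem[OF jk X U \<open>u \<in> U\<close>] A by simp
  from T.flattening[OF p U finite_keys this wX]
  obtain \<nu> y where y: "y \<in> U" "weight_vector sT \<rho>T \<nu> y" "flat p \<nu>"
    and \<nu>: "\<And>l. l \<in> Poly_Mapping.keys \<mu> \<Longrightarrow>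
      (Poly_Mapping.lookup (move_weight j k A \<mu>) l = 0 \<or> (\<exists>i. Poly_Mapping.lookup (move_weight j k A \<mu>) l = p ^ i) \<longrightarrow>
          Poly_Mapping.lookup \<nu> l = Poly_Mapping.lookup (move_weight j k A \<mu>) l) \<and>
       (0 < Poly_Mapping.lookup (move_weight j k A \<mu>) l \<longrightarrow>
          0 < Poly_Mapping.lookup \<nu> l \<and> Poly_Mapping.lookup \<nu> l \<le> Poly_Mapping.lookup (move_weight j k A \<mu>) l)"
    by blast
  have "flat_less p \<nu> \<mu>"
  proof (rule flat_less_by_splitting[OF \<open>p > 1\<close> r y(3)])
    have "j \<in> Poly_Mapping.keys \<mu>" using A by (auto simp: in_keys_iff)
    from \<nu>[OF this] show "0 < Poly_Mapping.lookup \<nu> j" "Poly_Mapping.lookup \<nu> j < p ^ r"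
      using A r by (auto simp: lookup_move_weight)
    fix l assume l: "l \<in> Poly_Mapping.keys \<mu>" "l \<noteq> j"
    then have "Poly_Mapping.lookup (move_weight j k A \<mu>) l = Poly_Mapping.lookup \<mu> l"
      using k by (auto simp: lookup_move_weight)
    with \<nu>[OF l(1)] \<mu>(2) show "Poly_Mapping.lookup \<nu> l = Poly_Mapping.lookup \<mu> l"
      unfolding flat_def by metis
  qed
  with minimal[OF y] show False by blast
qed

end
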